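(* Let $a,b,c,g$ be generic complex parameters, and let $f_{DF}^{(0,0)}$, $f_{DF}^{(0,1)}$, $f_{DF}^{(0,2)}$ be the normalized local solutions at $x=0$ of the Dotsenko–Fateev equation $S(a,b,c,g)$ with exponents $0$, $a+c+1$, $2a+2c+g+2$, respectively. (1) \begin{align*} \frac{f_{DF}^{(0,0)}(a,b,c,g;x)}{(1-x)^{b+c+1}} &=\sum_{n=0}^\infty x^n\frac{(-a-c-g)_n}{(-a-c-\frac g2)_n}[Z^n]\;{}_2F_1\!\left(\begin{matrix} -c,\ -a-b-c-\frac g2-1 \\ -a-c \end{matrix};Z\right){}_2F_1\!\left(\begin{matrix} b+1,\ -a-\frac g2 \\ -a-c-g \end{matrix};Z\right)\\ &=\sum_{n=0}^\infty x^n\frac{(-2a-b-c-g-1)_n(b-c+1)_n}{(-a-c)_n(-a-c-\frac g2)_n}[Z^n]\;{}_2F_1\!\left(\begin{matrix} -c,\ -c-\frac g2 \\ b-c+1 \end{matrix};Z\right){}_2F_1\!\left(\begin{matrix} -a,\ -a-\frac g2 \\ -2a-b-c-g-1 \end{matrix};Z\right)\\ &=\sum_{n=0}^\infty x^n\frac{(-a-c-\frac g2)_n}{(-a-c)_n}[Z^n]\;{}_2F_1\!\left(\begin{matrix} -c,\ -a-b-c-g-1 \\ -a-c-\frac g2 \end{matrix};Z\right){}_2F_1\!\left(\begin{matrix} b+1,\ -a \\ -a-c-\frac g2 \end{matrix};Z\right). \end{align*} (2) \begin{align*} \frac{f_{DF}^{(0,1)}(a,b,c,g;x)}{x^{a+c+1}(1-x)^{b+c+1}}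 &=\sum_{n=0}^\infty x^n\frac{(1-g)_n}{(1-\frac g2)_n}[Z^n]\;{}_2F_1\!\left(\begin{matrix} b+1,\ -a-\frac g2 \\ -a-c-g \end{matrix};Z\right){}_2F_1\!\left(\begin{matrix} a+1,\ -b-\frac g2 \\ a+c+2 \end{matrix};Z\right)\\ &=\sum_{n=0}^\infty x^n\frac{(1-g)_n(a+b+2)_n(-a-b-g)_n}{(1-\frac g2)_n(-a-c-g)_n(a+c+2)_n}[Z^n]\;{}_2F_1\!\left(\begin{matrix} c+1,\ -a-\frac g2 \\ -a-b-g \end{matrix};Z\right){}_2F_1\!\left(\begin{matrix} a+1,\ -c-\frac g2 \\ a+b+2 \end{matrix};Z\right)\\ &=\sum_{n=0}^\infty x^n\frac{(1-\frac g2)_n(1-g)_n}{(-a-c-g)_n(a+c+2)_n}[Z^n]\;{}_2F_1\!\left(\begin{matrix} a+1,\ -a-b-c-g-1 \\ 1-\frac g2 \end{matrix};Z\right){}_2F_1\!\left(\begin{matrix} b+1,\ c+1 \\ 1-\frac g2 \end{matrix};Z\right). \end{align*} (3) $$f_{DF}^{(0,2)}(a,b,c,g;x)=x^{2a+2c+g+2}f_{DF}^{(0,0)}\left(-c-\tfrac g2-1,\ a+b+c+\tfrac g2+1,\ -a-\tfrac g2-1,\ g;\ x\right).$$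
   Context: Notation: $(\alpha)_n=\alpha(\alpha+1)\cdots(\alpha+n-1)$; ${}_2F_1$ is the Gauss hypergeometric series; $[Z^n]$ picks the coefficient of $Z^n$ of the power series that follows it. "Normalized" local solution with exponent $\rho$ at $x=0$ means a solution of the form $x^\rho(1+\sum_{n\ge1}c_nx^n)$. Generic means outside a countable union of proper algebraic hypersurfaces of the parameter space. With $\partial=d/dx$, the Dotsenko–Fateev operator is $S(a,b,c,g)=x^2(x-1)^2\partial^3+s_1\partial^2+s_2\partial+s_3$, where \begin{align*} s_1&=-(x-1)x(3ax+3bx+6cx+2gx-3a-3c-g),\\ s_2&=2a^2x^2+4abx^2+12acx^2+3agx^2+2b^2x^2+12bcx^2+3bgx^2+12c^2x^2+8cgx^2\\ &\quad+g^2x^2-4a^2x-4abx-16acx-4agx+ax^2-8bcx-2bgx+bx^2-12c^2x-8cgx+6cx^2\\ &\quad-g^2x+gx^2+2a^2+4ac+ag-2ax+2c^2+cg-6cx-gx+a+c,\\ s_3&=-c(2a+2+2b+2c+g)(2ax+2bx+4cx+2gx-2a-2c-g+2x-1). \end{align*} Its local exponents at $x=0$ are $0,\ a+c+1,\ 2a+2c+g+2$. *)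

theory Defs
  imports "HOL-Analysis.Analysis"
begin

definition DF_s1 :: "complex \<Rightarrow> complex \<Rightarrow> complex \<Rightarrow> complex \<Rightarrow> complex \<Rightarrow> complex" where
  "DF_s1 a b c g x =
     - (x - 1) * x * (3*a*x + 3*b*x + 6*c*x + 2*g*x - 3*a - 3*c - g)"

definition DF_s2 :: "complex \<Rightarrow> complex \<Rightarrow> complex \<Rightarrow> complex \<Rightarrow> complex \<Rightarrow> complex" where
  "DF_s2 a b c g x =
     2*a^2*x^2 + 4*a*b*x^2 + 12*a*c*x^2 + 3*a*g*x^2 + 2*b^2*x^2 + 12*b*c*x^2
   + 3*b*g*x^2 + 12*c^2*x^2 + 8*c*g*x^2
   + g^2*x^2 - 4*a^2*x - 4*a*b*x - 16*a*c*x - 4*a*g*x + a*x^2 - 8*b*c*x - 2*b*g*x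
   + b*x^2 - 12*c^2*x - 8*c*g*x + 6*c*x^2
   - g^2*x + g*x^2 + 2*a^2 + 4*a*c + a*g - 2*a*x + 2*c^2 + c*g - 6*c*x - g*x + a + c"

definition DF_s3 :: "complex \<Rightarrow> complex \<Rightarrow> complex \<Rightarrow> complex \<Rightarrow> complex \<Rightarrow> complex" where
  "DF_s3 a b c g x =
     - c * (2*a + 2 + 2*b + 2*c + g)
         * (2*a*x + 2*b*x + 4*c*x + 2*g*x - 2*a - 2*c - g + 2*x - 1)"

definition DF_operator ::
  "complex \<Rightarrow> complex \<Rightarrow> complex \<Rightarrow> complex \<Rightarrow> (complex \<Rightarrow> complex) \<Rightarrow> complex \<Rightarrow> complex" where
  "DF_operator a b c g f x =
     x^2 * (x - 1)^2 * (deriv ^^ 3) f x + DF_s1 a b c g x * (deriv ^^ 2) f x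
     + DF_s2 a b c g x * deriv f x + DF_s3 a b c g x * f x"

text \<open>
  \<open>F\<close> is the power series part $1 + \sum_{n\ge 1} c_n x^n$ of a normalized local solution
  $x^\rho (1 + \sum_{n\ge 1} c_n x^n)$ at $x = 0$. Since \<open>powr\<close> is the principal branch, with
  its cut along the nonpositive reals, the equation is required near \<open>0\<close> off that cut.
\<close>

definition DF_normalized_series ::
  "complex \<Rightarrow> complex \<Rightarrow> complex \<Rightarrow> complex \<Rightarrow> complex \<Rightarrow> complex fps \<Rightarrow> bool" where
  "DF_normalized_series a b c g \<rho> F \<longleftrightarrow>
     fps_nth F 0 = 1 \<and> fps_conv_radius F > 0 \<and>
     (\<forall>\<^sub>F x in at 0 within (- \<real>\<^sub>\<le>\<^sub>0).
        DF_operator a b c g (\<lambda>z. z powr \<rho> * eval_fps F z) x = 0)"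

definition DF_local_solution ::
  "complex \<Rightarrow> complex \<Rightarrow> complex \<Rightarrow> complex \<Rightarrow> complex \<Rightarrow> complex \<Rightarrow> complex" where
  "DF_local_solution a b c g \<rho> x =
     x powr \<rho> * eval_fps (THE F. DF_normalized_series a b c g \<rho> F) x"

definition f_DF00 :: "complex \<Rightarrow> complex \<Rightarrow> complex \<Rightarrow> complex \<Rightarrow> complex \<Rightarrow> complex" where
  "f_DF00 a b c g = DF_local_solution a b c g 0"

definition f_DF01 :: "complex \<Rightarrow> complex \<Rightarrow> complex \<Rightarrow> complex \<Rightarrow> complex \<Rightarrow> complex" where
  "f_DF01 a b c g = DF_local_solution a b c g (a + c + 1)"

definition f_DF02 :: "complex \<Rightarrow> complex \<Rightarrow> complex \<Rightarrow> complex \<Rightarrow> complex \<Rightarrow> complex" where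
  "f_DF02 a b c g = DF_local_solution a b c g (2*a + 2*c + g + 2)"

definition gauss_2F1 :: "complex \<Rightarrow> complex \<Rightarrow> complex \<Rightarrow> complex fps" where
  "gauss_2F1 \<alpha> \<beta> \<gamma> = fps_hypergeo [\<alpha>, \<beta>] [\<gamma>] 1"

text \<open>A polynomial in four variables is represented as an iterated univariate polynomial.\<close>

definition poly4 ::
  "complex poly poly poly poly \<Rightarrow> complex \<Rightarrow> complex \<Rightarrow> complex \<Rightarrow> complex \<Rightarrow> complex" where
  "poly4 P a b c g = poly (poly (poly (poly P [:[:[:g:]:]:]) [:[:c:]:]) [:b:]) a"

definition proper_hypersurface :: "(complex \<times> complex \<times> complex \<times> complex) set \<Rightarrow> bool" where
  "proper_hypersurface V \<longleftrightarrow> (\<exists>P. P \<noteq> 0 \<and> V = {(a, b, c, g). poly4 P a b c g = 0})"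

definition generically ::
  "(complex \<Rightarrow> complex \<Rightarrow> complex \<Rightarrow> complex \<Rightarrow> bool) \<Rightarrow> bool" where
  "generically Q \<longleftrightarrow>
     (\<exists>\<V>. countable \<V> \<and> (\<forall>V\<in>\<V>. proper_hypersurface V) \<and>
        (\<forall>a b c g. (a, b, c, g) \<notin> \<Union>\<V> \<longrightarrow> Q a b c g))"

end

theory Submission
  imports Defs
begin

text \<open>
  Put $f = x^{\rho} (1-x)^{b+c+1} \sum_n u_n x^n$. The equation $S(a,b,c,g) f = 0$ becomes a three-term
  recurrence for $u_n$ with cubic coefficients; it determines $u_n$ from $u_0 = 1$ when no two
  exponents differ by an integer, and its solution has radius of convergence at least 1. On the
  other side, in each of the six formulas the two Gauss series have opposite Euler exponents, so the
  coefficient of $Z^n$ in their product is a terminating balanced ${}_4F_3(1)$. Whipple's transformation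
  brings the three series of (1), and likewise the three series of (2), to one common form
  ${}_4F_3(-n, n+t, p, q; d, e, f; 1)$ with $2d = t + 1$. This is a Racah polynomial in its degree \<open>n\<close>, and
  its three-term recurrence is the one of $u_n$. Part (3) holds because both the recurrence
  and $b + c + 1$ are invariant under the change of parameters.
\<close>

section \<open>Euler operators and powers of $1 - x$\<close>

text \<open>The relation 2d = t + 1 is what makes the degrees match. The general recurrence of such
  a series has coefficients of degree five in n; under this relation \<nu> + d and \<nu> + t - d are
  the halves of 2\<nu> + t + 1 and 2\<nu> + t - 1, so a quadratic factor common to all terms splits
  off and cubics remain. Dividing by it needs d not to be an integer; here d is -a-c-g/2 for the
  exponent 0 and 1-g/2 for the exponent a+c+1. Within each of (1) and (2) the three formulas have
  the same numerator parameters p, q and differ only in which lower parameter is the \<gamma> of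
  Whipple's transformation, so the symmetry of the series in d, e, f identifies them. On the
  analytic side the equation is available only off the cut of \<open>powr\<close>. There x^\<rho>
  does not vanish and the remaining factor is analytic at 0, so the equation is equivalent to one
  between formal power series, and what follows is algebra on coefficients, apart from the radius of
  convergence.\<close>

definition euler_op :: "'a::comm_ring_1 \<Rightarrow> 'a fps \<Rightarrow> 'a fps" where
  "euler_op \<rho> F = fps_X * fps_deriv F + fps_const \<rho> * F"

text \<open>The action on coefficients is diagonal, so an equation built from these operators and
  powers of \<open>fps_X\<close> is a recurrence. The number \<rho> accounts for a factor x^\<rho>
  that is itself not a power series.\<close>

lemma euler_op_nth [simp]: "fps_nth (euler_op \<rho> F) n = (\<rho> + of_nat n) * fps_nth F n"
  by (cases n) (simp_all add: euler_op_def algebra_simps)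

lemma euler_op_shift: "euler_op (\<rho> + \<sigma>) F = euler_op \<rho> F + fps_const \<sigma> * F"
  by (simp add: fps_eq_iff algebra_simps)

lemma euler_op_add: "euler_op \<rho> (F + G) = euler_op \<rho> F + euler_op \<rho> G"
  by (simp add: fps_eq_iff algebra_simps)

lemma euler_op_diff: "euler_op \<rho> (F - G) = euler_op \<rho> F - euler_op \<rho> G"
  by (simp add: fps_eq_iff algebra_simps)

lemma euler_op_const_mult: "euler_op \<rho> (fps_const c * F) = fps_const c * euler_op \<rho> F"
  by (simp add: fps_eq_iff algebra_simps)

lemma euler_op_mult: "euler_op \<rho> (F * G) = euler_op 0 F * G + F * euler_op \<rho> G"
  by (simp add: euler_op_def algebra_simps)

lemma euler_op_X: "euler_op 0 fps_X = fps_X"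
  by (simp add: euler_op_def)

lemma euler_op_X_mult: "euler_op \<rho> (fps_X * F) = fps_X * F + fps_X * euler_op \<rho> F"
  by (simp add: euler_op_mult euler_op_X)

lemma euler_op_1_minus_X_mult:
  "euler_op \<rho> ((1 - fps_X) * F) = (1 - fps_X) * euler_op \<rho> F - fps_X * F"
  by (simp add: left_diff_distrib euler_op_diff euler_op_X_mult)

definition fps_one_minus_powr :: "'a::field_char_0 \<Rightarrow> 'a fps" where
  "fps_one_minus_powr s = Abs_fps (\<lambda>n. pochhammer (- s) n / fact n)"

lemma fps_one_minus_powr_nth_0 [simp]: "fps_nth (fps_one_minus_powr s) 0 = 1"
  by (simp add: fps_one_minus_powr_def)

lemma one_minus_X_mult_deriv_powr:
  "(1 - fps_X) * fps_deriv (fps_one_minus_powr s) =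
      - fps_const s * fps_one_minus_powr s"
proof (rule fps_ext)
  fix n
  have *: "of_nat (Suc n) * fps_nth (fps_one_minus_powr s) (Suc n) =
      (of_nat n - s) * fps_nth (fps_one_minus_powr s) n" for n
    by (simp add: fps_one_minus_powr_def pochhammer_Suc field_simps del: of_nat_Suc)
  show "fps_nth ((1 - fps_X) * fps_deriv (fps_one_minus_powr s)) n =
      fps_nth (- fps_const s * fps_one_minus_powr s) n"
    using *[of n]
    by (cases n) (simp_all add: left_diff_distrib fps_deriv_nth del: of_nat_Suc flip: Suc_eq_plus1)
qed

lemma one_minus_fps_X_neq_0: "(1 - fps_X :: 'a::comm_ring_1 fps) \<noteq> 0"
  by (auto simp: fps_eq_iff intro!: exI[of _ 0])

text \<open>The logarithmic derivatives of the factors are opposite, so the product has derivative 0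
  and constant term 1.\<close>

lemma fps_one_minus_powr_mult_minus:
  "fps_one_minus_powr s * fps_one_minus_powr (- s) = 1"
proof -
  let ?P = "fps_one_minus_powr s" and ?Q = "fps_one_minus_powr (- s)"
  have "(1 - fps_X) * fps_deriv (?P * ?Q) =
      ((1 - fps_X) * fps_deriv ?P) * ?Q + ?P * ((1 - fps_X) * fps_deriv ?Q)"
    by (simp add: algebra_simps)
  also have "\<dots> = 0"
    by (simp only: one_minus_X_mult_deriv_powr) (simp add: algebra_simps flip: fps_const_neg)
  finally have "(1 - fps_X) * fps_deriv (?P * ?Q) = 0" .
  then have "fps_deriv (?P * ?Q) = 0"
    using one_minus_fps_X_neq_0 by simp
  then show ?thesis
    by (metis fps_deriv_eq_0_iff fps_const_1_eq_1 fps_mult_nth_0 fps_one_minus_powr_nth_0 mult_1)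
qed

text \<open>The Euler derivative of (1-x)^s is -s x/(1-x) times this power; the factor 1 - X on the
  left clears the pole. The rules of order two and three need its square and cube.\<close>

lemma euler_op_powr_mult:
  "(1 - fps_X) * euler_op \<rho> (fps_one_minus_powr s * H) =
     fps_one_minus_powr s * ((1 - fps_X) * euler_op \<rho> H - fps_const s * fps_X * H)"
proof -
  have "(1 - fps_X) * euler_op 0 (fps_one_minus_powr s) =
      - fps_const s * fps_X * fps_one_minus_powr s"
    using one_minus_X_mult_deriv_powr[of s] by (simp add: euler_op_def mult.left_commute)
  then show ?thesis
    by (simp only: euler_op_mult) algebra
qed

lemma euler_op2_powr_mult:
  "(1 - fps_X)^2 * euler_op \<rho> (euler_op \<rho> (fps_one_minus_powr s * H)) =
     fps_one_minus_powr s * ((1 - fps_X)^2 * euler_op \<rho> (euler_op \<rho> H)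
          - 2 * fps_const s * fps_X * (1 - fps_X) * euler_op \<rho> H
          + ((fps_const s)^2 * fps_X^2 - fps_const s * fps_X) * H)"
proof -
  let ?T = "euler_op \<rho>" and ?P = "fps_one_minus_powr s" and ?S = "fps_const s"
  let ?K = "(1 - fps_X) * ?T H - ?S * (fps_X * H)"
  have TK: "?T ?K = (1 - fps_X) * ?T (?T H) - fps_X * ?T H - ?S * (fps_X * H + fps_X * ?T H)"
    by (simp only: euler_op_diff euler_op_1_minus_X_mult euler_op_const_mult euler_op_X_mult)
  have 1: "(1 - fps_X) * ?T (?P * H) = ?P * ?K"
    by (simp add: euler_op_powr_mult mult.assoc)
  \<comment> \<open>The outer operator is moved past 1 - X, at the cost of a multiple of X, so that
    the first-order rule \<open>1\<close> applies inside.\<close>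
  have "(1 - fps_X) * ?T (?T (?P * H)) = ?T ((1 - fps_X) * ?T (?P * H)) + fps_X * ?T (?P * H)"
    by (simp add: euler_op_1_minus_X_mult)
  from this[unfolded 1] have "(1 - fps_X)^2 * ?T (?T (?P * H)) =
      (1 - fps_X) * ?T (?P * ?K) + fps_X * ((1 - fps_X) * ?T (?P * H))"
    by algebra
  also have "\<dots> = ?P * ((1 - fps_X) * ?T ?K - ?S * fps_X * ?K) + fps_X * (?P * ?K)"
    by (simp only: 1 euler_op_powr_mult[where H = ?K])
  also have "\<dots> = ?P * ((1 - fps_X)^2 * ?T (?T H)
          - 2 * ?S * fps_X * (1 - fps_X) * ?T H + (?S^2 * fps_X^2 - ?S * fps_X) * H)"
    unfolding TK by algebra
  finally show ?thesis .
qed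

lemma euler_op3_powr_mult:
  "(1 - fps_X)^3 * euler_op \<rho> (euler_op \<rho> (euler_op \<rho> (fps_one_minus_powr s * H))) =
     fps_one_minus_powr s * ((1 - fps_X)^3 * euler_op \<rho> (euler_op \<rho> (euler_op \<rho> H))
          - 3 * fps_const s * fps_X * (1 - fps_X)^2 * euler_op \<rho> (euler_op \<rho> H)
          + 3 * ((fps_const s)^2 * fps_X^2 - fps_const s * fps_X) * (1 - fps_X) * euler_op \<rho> H
          + (3 * (fps_const s)^2 * fps_X^2 - fps_const s * fps_X * (1 + fps_X) - (fps_const s)^3 * fps_X^3) * H)"
proof -
  let ?T = "euler_op \<rho>" and ?P = "fps_one_minus_powr s" and ?S = "fps_const s"
  let ?K = "(1 - fps_X) * ?T H - ?S * (fps_X * H)"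
  have TK: "?T ?K = (1 - fps_X) * ?T (?T H) - fps_X * ?T H - ?S * (fps_X * H + fps_X * ?T H)"
    by (simp only: euler_op_diff euler_op_1_minus_X_mult euler_op_const_mult euler_op_X_mult)
  have TTK: "?T (?T ?K) = ((1 - fps_X) * ?T (?T (?T H)) - fps_X * ?T (?T H))
      - (fps_X * ?T H + fps_X * ?T (?T H))
      - ?S * (fps_X * H + fps_X * ?T H + (fps_X * ?T H + fps_X * ?T (?T H)))"
    by (simp only: TK euler_op_diff euler_op_1_minus_X_mult euler_op_const_mult euler_op_X_mult
        euler_op_add)
  have 1: "(1 - fps_X) * ?T (?P * H) = ?P * ?K"
    by (simp add: euler_op_powr_mult mult.assoc)
  have "(1 - fps_X) * ?T (?T (?T (?P * H))) =
      ?T (?T ((1 - fps_X) * ?T (?P * H))) + fps_X * ?T (?P * H) + 2 * fps_X * ?T (?T (?P * H))"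
    by (simp add: euler_op_1_minus_X_mult euler_op_diff euler_op_add euler_op_X_mult)
  from this[unfolded 1] have "(1 - fps_X)^3 * ?T (?T (?T (?P * H))) = (1 - fps_X)^2 * ?T (?T (?P * ?K))
      + fps_X * (1 - fps_X) * ((1 - fps_X) * ?T (?P * H))
      + 2 * fps_X * ((1 - fps_X)^2 * ?T (?T (?P * H)))"
    by algebra
  also have "\<dots> = ?P * ((1 - fps_X)^2 * ?T (?T ?K) - 2 * ?S * fps_X * (1 - fps_X) * ?T ?K
        + (?S^2 * fps_X^2 - ?S * fps_X) * ?K)
      + fps_X * (1 - fps_X) * (?P * ?K)
      + 2 * fps_X * (?P * ((1 - fps_X)^2 * ?T (?T H)
          - 2 * ?S * fps_X * (1 - fps_X) * ?T H + (?S^2 * fps_X^2 - ?S * fps_X) * H))"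
    by (simp only: euler_op2_powr_mult 1)
  also have "\<dots> = ?P * ((1 - fps_X)^3 * ?T (?T (?T H))
          - 3 * ?S * fps_X * (1 - fps_X)^2 * ?T (?T H)
          + 3 * (?S^2 * fps_X^2 - ?S * fps_X) * (1 - fps_X) * ?T H
          + (3 * ?S^2 * fps_X^2 - ?S * fps_X * (1 + fps_X) - ?S^3 * fps_X^3) * H)"
    unfolding TTK unfolding TK by algebra
  finally show ?thesis .
qed

lemma eval_fps_one_minus_powr:
  fixes x :: complex
  shows "fps_conv_radius (fps_one_minus_powr s :: complex fps) \<ge> 1"
    and "norm x < 1 \<Longrightarrow> eval_fps (fps_one_minus_powr s) x = (1 - x) powr s"
proof -
  have sums: "(\<lambda>n. fps_nth (fps_one_minus_powr s) n * z ^ n) sums (1 - z) powr s"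
    if "norm z < 1" for z :: complex
  proof -
    have "(s gchoose n) * (- z) ^ n = fps_nth (fps_one_minus_powr s) n * z ^ n" for n
      by (simp add: gbinomial_pochhammer fps_one_minus_powr_def power_minus[of z] mult_ac)
    then show ?thesis
      using gen_binomial_complex[of "- z" s] that by simp
  qed
  show "fps_conv_radius (fps_one_minus_powr s :: complex fps) \<ge> 1"
    unfolding fps_conv_radius_def
    by (rule conv_radius_geI_ex') (auto intro!: sums_summable[OF sums] simp: one_ereal_def)
  show "norm x < 1 \<Longrightarrow> eval_fps (fps_one_minus_powr s) x = (1 - x) powr s"
    using sums[of x] by (simp add: eval_fps_def sums_iff)
qed

section \<open>Euler's transformation\<close>

lemma euler_op_conv_0: "euler_op \<rho> F = euler_op 0 F + fps_const \<rho> * F"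
  by (simp add: euler_op_def)

text \<open>The operator of Gauss's hypergeometric equation in its Euler form.\<close>

definition hypergeo_op :: "'a::field_char_0 \<Rightarrow> 'a \<Rightarrow> 'a \<Rightarrow> 'a fps \<Rightarrow> 'a fps" where
  "hypergeo_op \<alpha> \<beta> \<gamma> F = euler_op 0 (euler_op (\<gamma> - 1) F) - fps_X * euler_op \<alpha> (euler_op \<beta> F)"

lemma hypergeo_op_eq_0_iff:
  "hypergeo_op \<alpha> \<beta> \<gamma> F = 0 \<longleftrightarrow>
     (\<forall>n. of_nat (Suc n) * (\<gamma> + of_nat n) * fps_nth F (Suc n) =
          (\<alpha> + of_nat n) * (\<beta> + of_nat n) * fps_nth F n)"
proof -
  \<comment> \<open>The coefficient of X^0 vanishes by itself, because the outer
    \<open>euler_op 0\<close> kills it; the coefficient at \<open>Suc n\<close> is the step from n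
    to n + 1.\<close>
  have split: "(\<forall>n. Q n) \<longleftrightarrow> Q 0 \<and> (\<forall>n. Q (Suc n))" for Q :: "nat \<Rightarrow> bool"
    by (metis not0_implies_Suc)
  show ?thesis
    by (subst fps_eq_iff, subst split) (simp add: hypergeo_op_def mult.assoc)
qed

lemma gauss_2F1_nth:
  "fps_nth (gauss_2F1 \<alpha> \<beta> \<gamma>) n = pochhammer \<alpha> n * pochhammer \<beta> n / (pochhammer \<gamma> n * fact n)"
  by (simp add: gauss_2F1_def)

lemma hypergeo_op_gauss_2F1:
  assumes "\<gamma> \<notin> \<int>\<^sub>\<le>\<^sub>0"
  shows "hypergeo_op \<alpha> \<beta> \<gamma> (gauss_2F1 \<alpha> \<beta> \<gamma>) = 0"
proof -
  have "pochhammer \<gamma> n \<noteq> 0" "\<gamma> + of_nat n \<noteq> 0" for n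
    using assms plus_of_nat_eq_0_imp by (auto simp: pochhammer_eq_0_iff add_eq_0_iff)
  then show ?thesis
    by (simp add: hypergeo_op_eq_0_iff gauss_2F1_nth pochhammer_Suc divide_simps del: of_nat_Suc)
qed

lemma hypergeo_op_unique:
  assumes "\<gamma> \<notin> \<int>\<^sub>\<le>\<^sub>0" "hypergeo_op \<alpha> \<beta> \<gamma> F = 0" "hypergeo_op \<alpha> \<beta> \<gamma> G = 0"
    and "fps_nth F 0 = fps_nth G 0"
  shows "F = G"
proof (rule fps_ext)
  fix n show "fps_nth F n = fps_nth G n"
  proof (induction n)
    case (Suc n)
    have "\<gamma> + of_nat n \<noteq> 0"
      using assms(1) plus_of_nat_eq_0_imp by blast
    with Suc assms(2,3) show ?case
      unfolding hypergeo_op_eq_0_iff by (metis mult_left_cancel no_zero_divisors of_nat_neq_0)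
  qed (fact assms)
qed

text \<open>The exponents at x = 1 are 0 and \<gamma> - \<alpha> - \<beta>. Pulling out the power
  with the second exponent leaves 0 and its negative, with unchanged exponents at 0, so the
  remaining equation is again hypergeometric.\<close>

lemma hypergeo_op_powr_mult:
  "hypergeo_op \<alpha> \<beta> \<gamma> (fps_one_minus_powr (\<gamma> - \<alpha> - \<beta>) * F) =
     fps_one_minus_powr (\<gamma> - \<alpha> - \<beta>) * hypergeo_op (\<gamma> - \<alpha>) (\<gamma> - \<beta>) \<gamma> F"
proof -
  let ?P = "fps_one_minus_powr (\<gamma> - \<alpha> - \<beta>)"
  have expand: "hypergeo_op \<alpha> \<beta> \<gamma> F = euler_op 0 (euler_op 0 F) + (fps_const \<gamma> - 1) * euler_op 0 F
      - fps_X * (euler_op 0 (euler_op 0 F) + (fps_const \<alpha> + fps_const \<beta>) * euler_op 0 F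
      + fps_const \<alpha> * fps_const \<beta> * F)" for \<alpha> \<beta> F
    unfolding hypergeo_op_def euler_op_conv_0[of \<alpha>] euler_op_conv_0[of \<beta>]
      euler_op_conv_0[of "\<gamma> - 1"] euler_op_add euler_op_const_mult
    by (simp only: fps_const_1_eq_1 flip: fps_const_sub) algebra
  have S: "fps_const (\<gamma> - \<alpha> - \<beta>) = fps_const \<gamma> - fps_const \<alpha> - fps_const \<beta>"
    "fps_const (\<gamma> - \<alpha>) = fps_const \<gamma> - fps_const \<alpha>"
    "fps_const (\<gamma> - \<beta>) = fps_const \<gamma> - fps_const \<beta>"
    by simp_all
  have "(1 - fps_X) * hypergeo_op \<alpha> \<beta> \<gamma> (?P * F) =
      (1 - fps_X)^2 * euler_op 0 (euler_op 0 (?P * F))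
      + (fps_const \<gamma> - 1 - fps_X * (fps_const \<alpha> + fps_const \<beta>)) * ((1 - fps_X) * euler_op 0 (?P * F))
      - (1 - fps_X) * fps_X * fps_const \<alpha> * fps_const \<beta> * (?P * F)"
    unfolding expand by algebra
  also have "\<dots> = (1 - fps_X) * (?P * hypergeo_op (\<gamma> - \<alpha>) (\<gamma> - \<beta>) \<gamma> F)"
    unfolding euler_op_powr_mult euler_op2_powr_mult expand S by algebra
  finally have "(1 - fps_X) * hypergeo_op \<alpha> \<beta> \<gamma> (?P * F) =
      (1 - fps_X) * (?P * hypergeo_op (\<gamma> - \<alpha>) (\<gamma> - \<beta>) \<gamma> F)" .
  with one_minus_fps_X_neq_0 show ?thesis
    by simp
qed

theorem gauss_2F1_euler:
  assumes "\<gamma> \<notin> \<int>\<^sub>\<le>\<^sub>0"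
  shows "gauss_2F1 \<alpha> \<beta> \<gamma> =
    fps_one_minus_powr (\<gamma> - \<alpha> - \<beta>) * gauss_2F1 (\<gamma> - \<alpha>) (\<gamma> - \<beta>) \<gamma>"
  using assms
  by (rule hypergeo_op_unique[of \<gamma> \<alpha> \<beta>])
    (simp_all add: hypergeo_op_powr_mult hypergeo_op_gauss_2F1 gauss_2F1_nth assms)

text \<open>Under the third assumption the two powers of 1 - x produced by Euler's transformation
  are inverse to each other.\<close>

corollary gauss_2F1_mult_euler:
  assumes "\<gamma> \<notin> \<int>\<^sub>\<le>\<^sub>0" "\<gamma>' \<notin> \<int>\<^sub>\<le>\<^sub>0" "\<alpha> + \<beta> - \<gamma> + (\<alpha>' + \<beta>' - \<gamma>') = 0"
  shows "gauss_2F1 \<alpha> \<beta> \<gamma> * gauss_2F1 \<alpha>' \<beta>' \<gamma>' =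
    gauss_2F1 (\<gamma> - \<alpha>) (\<gamma> - \<beta>) \<gamma> * gauss_2F1 (\<gamma>' - \<alpha>') (\<gamma>' - \<beta>') \<gamma>'"
proof -
  let ?P = "fps_one_minus_powr (\<gamma> - \<alpha> - \<beta>)" and ?Q = "fps_one_minus_powr (\<gamma>' - \<alpha>' - \<beta>')"
  have "\<gamma>' - \<alpha>' - \<beta>' = - (\<gamma> - \<alpha> - \<beta>)"
    using assms(3) by (simp add: algebra_simps add_eq_0_iff)
  then have "?P * ?Q = 1"
    by (simp only: fps_one_minus_powr_mult_minus)
  moreover have "gauss_2F1 \<alpha> \<beta> \<gamma> * gauss_2F1 \<alpha>' \<beta>' \<gamma>' = (?P * ?Q) *
      (gauss_2F1 (\<gamma> - \<alpha>) (\<gamma> - \<beta>) \<gamma> * gauss_2F1 (\<gamma>' - \<alpha>') (\<gamma>' - \<beta>') \<gamma>')"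
    unfolding gauss_2F1_euler[OF assms(1), of \<alpha> \<beta>] gauss_2F1_euler[OF assms(2), of \<alpha>' \<beta>']
    by (simp only: ac_simps)
  ultimately show ?thesis
    by simp
qed

section \<open>Balanced terminating series\<close>

text \<open>The factors of (1-y-n)_(n-k) are, in reverse order, the negatives of y+k, ..., y+n-1,
  which complete (y)_k to (y)_n.\<close>

lemma pochhammer_reverse:
  fixes y :: "'a::comm_ring_1"
  assumes "k \<le> n"
  shows "pochhammer (1 - y - of_nat n) (n - k) * pochhammer y k = (- 1) ^ (n - k) * pochhammer y n"
proof -
  have "1 - y - of_nat n = - (y + of_nat k + of_nat (n - k) - 1)"
    using assms by (simp add: of_nat_diff)
  then have "pochhammer (1 - y - of_nat n) (n - k) = (- 1) ^ (n - k) * pochhammer (y + of_nat k) (n - k)"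
    by (simp only: pochhammer_minus) simp
  then show ?thesis
    using assms by (simp add: pochhammer_product[of k n])
qed

section \<open>Series of Racah type and their recurrence in the degree\<close>

definition racah_term ::
  "'a::field_char_0 \<Rightarrow> 'a \<Rightarrow> 'a \<Rightarrow> 'a \<Rightarrow> 'a \<Rightarrow> nat \<Rightarrow> 'a" where
  "racah_term t d e f \<nu> k = pochhammer (- \<nu>) k * pochhammer (\<nu> + t) k /
     (fact k * pochhammer d k * pochhammer e k * pochhammer f k)"

text \<open>
  \<open>racah t p q d e f n\<close> is the terminating series ${}_4F_3(-n, n+t, p, q; d, e, f; 1)$. In \<open>racah_term\<close>
  the degree is a field element, so that passing to $n - 1$ needs no truncated subtraction.
\<close>

definition racah ::
  "'a::field_char_0 \<Rightarrow> 'a \<Rightarrow> 'a \<Rightarrow> 'a \<Rightarrow> 'a \<Rightarrow> 'a \<Rightarrow> nat \<Rightarrow> 'a" where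
  "racah t p q d e f n =
     (\<Sum>k\<le>n. racah_term t d e f (of_nat n) k * (pochhammer p k * pochhammer q k))"

lemma racah_0 [simp]: "racah t p q d e f 0 = 1"
  by (simp add: racah_def racah_term_def)

text \<open>The factor (-n)_k vanishes for k > n. Hence series of neighbouring degrees can be summed
  over one common range.\<close>

lemma racah_extend:
  assumes "n \<le> N"
  shows "racah t p q d e f n =
    (\<Sum>k\<le>N. racah_term t d e f (of_nat n) k * (pochhammer p k * pochhammer q k))"
  unfolding racah_def
  by (rule sum.mono_neutral_left)
    (use assms in \<open>auto simp: racah_term_def pochhammer_of_nat_eq_0_iff\<close>)

context
  fixes t p q d e f :: "'a::field_char_0"
  assumes balanced: "t + p + q + 1 = d + e + f"
    and nonpole: "d \<notin> \<int>\<^sub>\<le>\<^sub>0" "e \<notin> \<int>\<^sub>\<le>\<^sub>0" "f \<notin> \<int>\<^sub>\<le>\<^sub>0"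
begin

text \<open>A telescoping certificate: the k-th summand of the recurrence is G(k+1) - G(k) up to a
  factor free of k, where G(k) = \<tau>_(k-1) \<phi>_k and G(0) = 0.\<close>

lemma racah_term_recurrence:
  defines "\<tau> \<equiv> racah_term t d e f" and "\<phi> \<equiv> \<lambda>k. pochhammer p k * pochhammer q k"
  shows "(2*\<nu> + t - 1) * (2*\<nu> + t) * (2*\<nu> + t + 1) * p * q * (\<tau> \<nu> k * \<phi> k)
     + (2*\<nu> + t - 1) * ((\<nu> + t) * (\<nu> + d) * (\<nu> + e) * (\<nu> + f)) * (\<tau> (\<nu> + 1) k * \<phi> k - \<tau> \<nu> k * \<phi> k)
     - (2*\<nu> + t + 1) * (\<nu> * (\<nu> + t - d) * (\<nu> + t - e) * (\<nu> + t - f)) * (\<tau> \<nu> k * \<phi> k - \<tau> (\<nu> - 1) k * \<phi> k)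
     = (2*\<nu> + t - 1) * (2*\<nu> + t) * (2*\<nu> + t + 1) *
       (\<tau> \<nu> k * \<phi> (Suc k) - (case k of 0 \<Rightarrow> 0 | Suc j \<Rightarrow> \<tau> \<nu> j * \<phi> k))"
proof (cases k)
  case 0
  then show ?thesis
    by (simp add: \<tau>_def \<phi>_def racah_term_def)
next
  case (Suc j)
  define J :: 'a where "J = of_nat j"
  \<comment> \<open>The ratio of the denominators of the terms k and j = k - 1. After multiplication
    by it the terms of the recurrence become polynomial multiples of \<open>Y\<close>.\<close>
  define D where "D = (J + 1) * (d + J) * (e + J) * (f + J)"
  define Y where "Y = \<tau> \<nu> j"
  define den where "den = fact j * pochhammer d j * pochhammer e j * pochhammer f j"
  have J: "d + J \<noteq> 0" "e + J \<noteq> 0" "f + J \<noteq> 0"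
    using nonpole plus_of_nat_eq_0_imp[of _ j] by (auto simp: J_def)
  moreover have "J + 1 \<noteq> 0"
    by (metis J_def add.commute of_nat_Suc of_nat_neq_0)
  ultimately have "D \<noteq> 0"
    by (simp add: D_def)
  have den: "fact k * pochhammer d k * pochhammer e k * pochhammer f k = den * D"
    by (simp add: Suc den_def D_def J_def pochhammer_Suc)
  have Y: "Y = pochhammer (- \<nu>) j * pochhammer (\<nu> + t) j / den"
    by (simp add: Y_def \<tau>_def racah_term_def den_def)
  have shift1: "x * pochhammer (x + 1) j = pochhammer x j * (x + J)" for x :: 'a
    by (metis J_def pochhammer_Suc pochhammer_rec)
  have 0: "D * \<tau> \<nu> k = (J - \<nu>) * (\<nu> + t + J) * Y"
    using \<open>D \<noteq> 0\<close> unfolding \<tau>_def racah_term_def den Y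
    by (simp add: Suc pochhammer_Suc J_def)
  have clear: "D * (z * \<tau> \<mu> k) = z * (pochhammer (- \<mu>) k * pochhammer (\<mu> + t) k) / den" for z \<mu>
    using \<open>D \<noteq> 0\<close> unfolding \<tau>_def racah_term_def den by simp
  \<comment> \<open>The coefficient \<nu> + t of the recurrence turns (\<nu>+t+1)_j into a multiple
    of (\<nu>+t)_j without any division; below, \<nu> does the same for (1-\<nu>)_j.\<close>
  have "(\<nu> + t) * (pochhammer (- (\<nu> + 1)) k * pochhammer (\<nu> + 1 + t) k) =
      - (\<nu> + 1) * (\<nu> + 1 + t + J) * pochhammer (- \<nu>) j * ((\<nu> + t) * pochhammer (\<nu> + t + 1) j)"
    unfolding Suc pochhammer_rec[of "- (\<nu> + 1)"] pochhammer_Suc[of "\<nu> + 1 + t"]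
    by (simp add: J_def ac_simps)
  then have 1: "D * ((\<nu> + t) * \<tau> (\<nu> + 1) k) = - (\<nu> + 1) * (\<nu> + 1 + t + J) * (\<nu> + t + J) * Y"
    unfolding shift1 clear Y by (simp only: divide_inverse ac_simps)
  have "\<nu> * (pochhammer (- (\<nu> - 1)) k * pochhammer (\<nu> - 1 + t) k) =
      (- 1) * (- \<nu> * pochhammer (- \<nu> + 1) j) * (1 - \<nu> + J) * (\<nu> - 1 + t) * pochhammer (\<nu> + t) j"
    unfolding Suc pochhammer_rec[of "\<nu> - 1 + t"] pochhammer_Suc[of "- (\<nu> - 1)"]
    by (simp add: J_def ac_simps)
  then have 2: "D * (\<nu> * \<tau> (\<nu> - 1) k) = (- 1) * (- \<nu> + J) * (1 - \<nu> + J) * (\<nu> - 1 + t) * Y"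
    unfolding shift1 clear Y by (simp only: divide_inverse ac_simps)
  have \<phi>: "\<phi> (Suc k) = \<phi> k * ((p + J + 1) * (q + J + 1))"
    by (simp add: \<phi>_def Suc pochhammer_Suc[of _ "Suc j"] J_def ac_simps)
  \<comment> \<open>The cofactor of (2\<nu>+t-1)(2\<nu>+t+1)(J+1)Y in the cleared identity; this is
    where the balancing condition enters.\<close>
  have core: "(2*\<nu> + t) * ((d + J) * (e + J) * (f + J) - (J - \<nu>) * (\<nu> + t + J) * (J + p + q + 1))
      - (\<nu> + d) * (\<nu> + e) * (\<nu> + f) * (\<nu> + t + J)
      + (\<nu> - J) * (\<nu> + t - d) * (\<nu> + t - e) * (\<nu> + t - f) = 0"
    using balanced by algebra
  let ?Q = "(2*\<nu> + t - 1) * (2*\<nu> + t) * (2*\<nu> + t + 1)"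
  \<comment> \<open>Stated for free variables; it only carries \<open>D\<close> to the places where
    the cleared forms can be substituted.\<close>
  have linear: "D * (Q * p * q * x + m1 * (n * d1 * e1 * f1) * (y - x) - m2 * (l * d2 * e2 * f2) * (x - z)
      - Q * (x * r - Y)) =
      Q * p * q * (D * x) + m1 * (d1 * e1 * f1) * (D * (n * y) - n * (D * x))
      - m2 * (d2 * e2 * f2) * (l * (D * x) - D * (l * z)) - Q * ((D * x) * r - D * Y)"
    for Q x m1 n d1 e1 f1 y m2 l d2 e2 f2 z r
    by algebra
  have up: "D * ((\<nu> + t) * \<tau> (\<nu> + 1) k) - (\<nu> + t) * (D * \<tau> \<nu> k) =
      - (J + 1) * (2*\<nu> + t + 1) * (\<nu> + t + J) * Y"
    unfolding 0 1 by algebra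
  have down: "\<nu> * (D * \<tau> \<nu> k) - D * (\<nu> * \<tau> (\<nu> - 1) k) = - (J + 1) * (2*\<nu> + t - 1) * (\<nu> - J) * Y"
    unfolding 0 2 by algebra
  have "D * (?Q * p * q * \<tau> \<nu> k
     + (2*\<nu> + t - 1) * ((\<nu> + t) * (\<nu> + d) * (\<nu> + e) * (\<nu> + f)) * (\<tau> (\<nu> + 1) k - \<tau> \<nu> k)
     - (2*\<nu> + t + 1) * (\<nu> * (\<nu> + t - d) * (\<nu> + t - e) * (\<nu> + t - f)) * (\<tau> \<nu> k - \<tau> (\<nu> - 1) k)
     - ?Q * (\<tau> \<nu> k * ((p + J + 1) * (q + J + 1)) - Y)) =
     (2*\<nu> + t - 1) * (2*\<nu> + t + 1) * Y * (J + 1) *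
     ((2*\<nu> + t) * ((d + J) * (e + J) * (f + J) - (J - \<nu>) * (\<nu> + t + J) * (J + p + q + 1))
      - (\<nu> + d) * (\<nu> + e) * (\<nu> + f) * (\<nu> + t + J)
      + (\<nu> - J) * (\<nu> + t - d) * (\<nu> + t - e) * (\<nu> + t - f))"
    unfolding linear up down unfolding 0 unfolding D_def by algebra
  also have "\<dots> = 0"
    unfolding core by simp
  finally have "?Q * p * q * \<tau> \<nu> k
     + (2*\<nu> + t - 1) * ((\<nu> + t) * (\<nu> + d) * (\<nu> + e) * (\<nu> + f)) * (\<tau> (\<nu> + 1) k - \<tau> \<nu> k)
     - (2*\<nu> + t + 1) * (\<nu> * (\<nu> + t - d) * (\<nu> + t - e) * (\<nu> + t - f)) * (\<tau> \<nu> k - \<tau> (\<nu> - 1) k)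
     = ?Q * (\<tau> \<nu> k * ((p + J + 1) * (q + J + 1)) - Y)"
    using \<open>D \<noteq> 0\<close> by simp
  then have "\<phi> k * (?Q * p * q * \<tau> \<nu> k
     + (2*\<nu> + t - 1) * ((\<nu> + t) * (\<nu> + d) * (\<nu> + e) * (\<nu> + f)) * (\<tau> (\<nu> + 1) k - \<tau> \<nu> k)
     - (2*\<nu> + t + 1) * (\<nu> * (\<nu> + t - d) * (\<nu> + t - e) * (\<nu> + t - f)) * (\<tau> \<nu> k - \<tau> (\<nu> - 1) k))
     = \<phi> k * (?Q * (\<tau> \<nu> k * ((p + J + 1) * (q + J + 1)) - Y))"
    by (rule arg_cong)
  then show ?thesis
    unfolding \<phi> by (simp only: Suc nat.case flip: Y_def) algebra
qed

text \<open>Summed over k up to n + 1, the certificate telescopes to a multiple of \<tau>_(n+1)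
  \<phi>_(n+2), which vanishes since (-n)_(n+1) = 0.\<close>

theorem racah_recurrence:
  fixes n :: nat
  defines "W \<equiv> racah t p q d e f" and "\<nu> \<equiv> of_nat n :: 'a"
  shows "(2*\<nu> + t - 1) * (2*\<nu> + t) * (2*\<nu> + t + 1) * p * q * W n
     + (2*\<nu> + t - 1) * ((\<nu> + t) * (\<nu> + d) * (\<nu> + e) * (\<nu> + f)) * (W (Suc n) - W n)
     - (2*\<nu> + t + 1) * (\<nu> * (\<nu> + t - d) * (\<nu> + t - e) * (\<nu> + t - f)) * (W n - W (n - 1)) = 0"
proof -
  define \<tau> where "\<tau> = racah_term t d e f"
  define \<phi> where "\<phi> k = pochhammer p k * pochhammer q k" for k
  define V where "V \<mu> = (\<Sum>k\<le>Suc n. \<tau> \<mu> k * \<phi> k)" for \<mu>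
  let ?Q = "(2*\<nu> + t - 1) * (2*\<nu> + t) * (2*\<nu> + t + 1)"
  have V: "V \<nu> = W n" "V (\<nu> + 1) = W (Suc n)"
    unfolding V_def W_def \<tau>_def \<phi>_def \<nu>_def by (simp_all add: racah_extend[of _ "Suc n"] add.commute)
  \<comment> \<open>For n = 0 the truncated \<open>n - 1\<close> is 0 and
    \<open>V (\<nu> - 1)\<close> need not be \<open>W 0\<close>; the factor \<nu> makes both sides
    0.\<close>
  have V': "\<nu> * V (\<nu> - 1) = \<nu> * W (n - 1)"
    unfolding V_def W_def \<tau>_def \<phi>_def \<nu>_def
    using racah_extend[of "n - 1" "Suc n" t p q d e f] by (cases n) (simp_all del: sum.atMost_Suc)
  have tele: "(\<Sum>k\<le>N. \<tau> \<nu> k * \<phi> (Suc k) - (case k of 0 \<Rightarrow> 0 | Suc j \<Rightarrow> \<tau> \<nu> j * \<phi> k)) =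
      \<tau> \<nu> N * \<phi> (Suc N)" for N
    by (induction N) simp_all
  have "?Q * p * q * V \<nu>
     + (2*\<nu> + t - 1) * ((\<nu> + t) * (\<nu> + d) * (\<nu> + e) * (\<nu> + f)) * (V (\<nu> + 1) - V \<nu>)
     - (2*\<nu> + t + 1) * (\<nu> * (\<nu> + t - d) * (\<nu> + t - e) * (\<nu> + t - f)) * (V \<nu> - V (\<nu> - 1)) =
     (\<Sum>k\<le>Suc n. ?Q * (\<tau> \<nu> k * \<phi> (Suc k) - (case k of 0 \<Rightarrow> 0 | Suc j \<Rightarrow> \<tau> \<nu> j * \<phi> k)))"
    unfolding V_def sum_distrib_left sum_subtractf[symmetric] sum.distrib[symmetric]
    by (rule sum.cong[OF refl]) (simp only: \<tau>_def \<phi>_def racah_term_recurrence)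
  also have "\<dots> = ?Q * (\<tau> \<nu> (Suc n) * \<phi> (Suc (Suc n)))"
    by (simp only: tele flip: sum_distrib_left)
  also have "\<dots> = 0"
    by (simp add: \<tau>_def \<nu>_def racah_term_def pochhammer_of_nat_eq_0_iff)
  finally show ?thesis
    using V V' by algebra
qed

end

section \<open>Coefficients of products of two Gauss series as Racah type series\<close>

lemma pochhammer_neg_of_nat_mult_fact:
  assumes "k \<le> n"
  shows "pochhammer (- of_nat n) k * fact (n - k) = (- 1) ^ k * (fact n :: 'a::{comm_ring_1,semiring_char_0})"
  using pochhammer_reverse[of "n - k" n "1 :: 'a"] assms by (simp add: pochhammer_fact)

lemma pochhammer_neq_0_if_not_nonpos_Int:
  "x \<notin> \<int>\<^sub>\<le>\<^sub>0 \<Longrightarrow> pochhammer x n \<noteq> (0 :: 'a::field_char_0)"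
  by (auto simp: pochhammer_eq_0_iff)

text \<open>
  Whipple's transformation: reversing the factors $(\alpha)_k$ and $(\gamma')_{n-k}$ turns the coefficient
  into one of a product whose parameters depend on \<open>n\<close>, to which Euler's transformation applies.
\<close>

theorem gauss_2F1_mult_nth_eq_racah:
  assumes balanced: "\<alpha> + \<beta> - \<gamma> + (\<alpha>' + \<beta>' - \<gamma>') = 0"
    and nonpole: "\<gamma> \<notin> \<int>\<^sub>\<le>\<^sub>0" "\<gamma>' \<notin> \<int>\<^sub>\<le>\<^sub>0" "\<alpha> \<notin> \<int>" "\<alpha> + \<alpha>' \<notin> \<int>\<^sub>\<le>\<^sub>0" "\<alpha> + \<beta>' \<notin> \<int>\<^sub>\<le>\<^sub>0"
  shows "fps_nth (gauss_2F1 \<alpha> \<beta> \<gamma> * gauss_2F1 \<alpha>' \<beta>' \<gamma>') n =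
    pochhammer (\<alpha> + \<alpha>') n * pochhammer (\<alpha> + \<beta>') n / (pochhammer \<gamma>' n * fact n) *
    racah (\<gamma> + \<gamma>' - 1) \<alpha> (\<gamma> - \<beta>) \<gamma> (\<alpha> + \<alpha>') (\<alpha> + \<beta>') n"
proof -
  let ?N = "of_nat n :: complex"
  have "\<alpha> \<notin> \<int>\<^sub>\<le>\<^sub>0"
    using nonpole(3) nonpos_Ints_Int by blast
  note nz = this[THEN pochhammer_neq_0_if_not_nonpos_Int]
    nonpole(1,2,4,5)[THEN pochhammer_neq_0_if_not_nonpos_Int]
  \<comment> \<open>This is the lower parameter of the reversed second factor. To be admissible for
    every n it needs \<alpha> to be no integer at all.\<close>
  have "1 - \<alpha> - ?N \<notin> \<int>\<^sub>\<le>\<^sub>0"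
  proof
    assume "1 - \<alpha> - ?N \<in> \<int>\<^sub>\<le>\<^sub>0"
    then have "1 - ?N - (1 - \<alpha> - ?N) \<in> \<int>"
      by (intro Ints_diff Ints_1 Ints_of_nat nonpos_Ints_Int)
    then show False
      using nonpole(3) by simp
  qed
  note euler = gauss_2F1_mult_euler[of \<gamma> "1 - \<alpha> - ?N" \<beta> "1 - \<gamma>' - ?N" \<alpha>' \<beta>', OF nonpole(1) this]
  have "fps_nth (gauss_2F1 \<alpha> \<beta> \<gamma> * gauss_2F1 \<alpha>' \<beta>' \<gamma>') n =
      (- 1) ^ n * pochhammer \<alpha> n / pochhammer \<gamma>' n *
      fps_nth (gauss_2F1 \<beta> (1 - \<gamma>' - ?N) \<gamma> * gauss_2F1 \<alpha>' \<beta>' (1 - \<alpha> - ?N)) n"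
    unfolding fps_mult_nth sum_distrib_left
  proof (rule sum.cong[OF refl])
    fix k assume "k \<in> {0..n}"
    then have k: "k \<le> n" by simp
    have sgn: "(- 1) ^ n = (- 1) ^ (n - k) * (- 1 :: complex) ^ k"
      using k by (simp flip: power_add)
    have a: "pochhammer (1 - \<alpha> - ?N) (n - k) * pochhammer \<alpha> k = (- 1) ^ (n - k) * pochhammer \<alpha> n"
      using k by (rule pochhammer_reverse)
    have c: "pochhammer (1 - \<gamma>' - ?N) k * pochhammer \<gamma>' (n - k) = (- 1) ^ k * pochhammer \<gamma>' n"
      using pochhammer_reverse[of "n - k" n \<gamma>'] k by simp
    have "pochhammer (1 - \<alpha> - ?N) (n - k) \<noteq> 0"
      using a nz(1)[of n] by auto
    moreover have "pochhammer \<alpha> k = (- 1) ^ (n - k) * pochhammer \<alpha> n / pochhammer (1 - \<alpha> - ?N) (n - k)"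
      using a calculation by (simp add: field_simps)
    moreover have "pochhammer (1 - \<gamma>' - ?N) k = (- 1) ^ k * pochhammer \<gamma>' n / pochhammer \<gamma>' (n - k)"
      using c nz(3) by (simp add: field_simps)
    ultimately show "fps_nth (gauss_2F1 \<alpha> \<beta> \<gamma>) k * fps_nth (gauss_2F1 \<alpha>' \<beta>' \<gamma>') (n - k) =
      (- 1) ^ n * pochhammer \<alpha> n / pochhammer \<gamma>' n * (fps_nth (gauss_2F1 \<beta> (1 - \<gamma>' - ?N) \<gamma>) k *
        fps_nth (gauss_2F1 \<alpha>' \<beta>' (1 - \<alpha> - ?N)) (n - k))"
      unfolding gauss_2F1_nth sgn using nz(3) by (simp add: ac_simps)
  qed
  \<comment> \<open>Reversal has replaced \<alpha> by 1-\<gamma>'-n and \<gamma>' by 1-\<alpha>-n,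
    which leaves the sum of upper minus lower parameters unchanged; so \<open>balanced\<close> is
    what \<open>euler\<close> asks for.\<close>
  also have "gauss_2F1 \<beta> (1 - \<gamma>' - ?N) \<gamma> * gauss_2F1 \<alpha>' \<beta>' (1 - \<alpha> - ?N) =
      gauss_2F1 (\<gamma> - \<beta>) (?N + (\<gamma> + \<gamma>' - 1)) \<gamma> *
      gauss_2F1 (1 - (\<alpha> + \<alpha>') - ?N) (1 - (\<alpha> + \<beta>') - ?N) (1 - \<alpha> - ?N)"
    using euler balanced by (simp add: algebra_simps)
  also have "(- 1) ^ n * pochhammer \<alpha> n / pochhammer \<gamma>' n * fps_nth \<dots> n =
    pochhammer (\<alpha> + \<alpha>') n * pochhammer (\<alpha> + \<beta>') n / (pochhammer \<gamma>' n * fact n) *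
    racah (\<gamma> + \<gamma>' - 1) \<alpha> (\<gamma> - \<beta>) \<gamma> (\<alpha> + \<alpha>') (\<alpha> + \<beta>') n"
    unfolding fps_mult_nth racah_def atMost_atLeast0 sum_distrib_left
  proof (rule sum.cong[OF refl])
    fix k assume "k \<in> {0..n}"
    then have k: "k \<le> n" by simp
    \<comment> \<open>A second reversal, for the transformed second factor: its upper parameters
      1-y-n become lower parameters y, and its lower parameter 1-\<alpha>-n gives back
      (\<alpha>)_k.\<close>
    have rev: "pochhammer (1 - y - ?N) (n - k) = (- 1) ^ (n - k) * pochhammer y n / pochhammer y k"
      if "pochhammer y k \<noteq> 0" for y
      using pochhammer_reverse[OF k, of y] that by (simp add: field_simps)
    \<comment> \<open>The source of the numerator parameter -n.\<close>
    have fct: "1 / fact (n - k) = (- 1) ^ k * pochhammer (- ?N) k / fact n"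
    proof -
      have "1 * fact n = (- 1) ^ k * pochhammer (- ?N) k * fact (n - k)"
        by (simp add: pochhammer_neg_of_nat_mult_fact[OF k] mult.assoc)
      then show ?thesis
        by (rule frac_eq_eq[OF fact_nonzero fact_nonzero, THEN iffD2])
    qed
    have sgn: "(- 1) ^ n = (- 1) ^ (n - k) * (- 1 :: complex) ^ k"
      using k by (simp flip: power_add)
    have sq: "(- 1) ^ m * ((- 1) ^ m * z) = z" for m and z :: complex
      by (simp flip: mult.assoc power_mult_distrib)
    show "(- 1) ^ n * pochhammer \<alpha> n / pochhammer \<gamma>' n *
        (fps_nth (gauss_2F1 (\<gamma> - \<beta>) (?N + (\<gamma> + \<gamma>' - 1)) \<gamma>) k *
         fps_nth (gauss_2F1 (1 - (\<alpha> + \<alpha>') - ?N) (1 - (\<alpha> + \<beta>') - ?N) (1 - \<alpha> - ?N)) (n - k)) =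
       pochhammer (\<alpha> + \<alpha>') n * pochhammer (\<alpha> + \<beta>') n / (pochhammer \<gamma>' n * fact n) *
       (racah_term (\<gamma> + \<gamma>' - 1) \<gamma> (\<alpha> + \<alpha>') (\<alpha> + \<beta>') ?N k * (pochhammer \<alpha> k * pochhammer (\<gamma> - \<beta>) k))"
    proof -
      have "fps_nth (gauss_2F1 (1 - (\<alpha> + \<alpha>') - ?N) (1 - (\<alpha> + \<beta>') - ?N) (1 - \<alpha> - ?N)) (n - k) =
        (- 1) ^ (n - k) * pochhammer (\<alpha> + \<alpha>') n * pochhammer (\<alpha> + \<beta>') n * pochhammer \<alpha> k /
        (pochhammer (\<alpha> + \<alpha>') k * pochhammer (\<alpha> + \<beta>') k * pochhammer \<alpha> n) * (1 / fact (n - k))"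
        unfolding gauss_2F1_nth rev[OF nz(1)] rev[OF nz(4)] rev[OF nz(5)]
        using nz by (cases "even (n - k)") (simp_all add: ac_simps)
      then show ?thesis
        unfolding gauss_2F1_nth[of "\<gamma> - \<beta>"] racah_term_def fct sgn
        using nz(1)[of n] by (simp add: sq ac_simps)
    qed
  qed
  finally show ?thesis .
qed

lemma racah_swap: "racah t p q d e f = racah t p q e d f" "racah t p q d e f = racah t p q d f e"
  by (simp_all add: racah_def racah_term_def fun_eq_iff ac_simps)

lemma racah_recurrence_half:
  fixes t p q d e f :: "'a::field_char_0" and n :: nat
  assumes half: "t + 1 = 2 * d" and balanced: "t + p + q + 1 = d + e + f"
    and nonpole: "d \<notin> \<int>" "e \<notin> \<int>\<^sub>\<le>\<^sub>0" "f \<notin> \<int>\<^sub>\<le>\<^sub>0"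
  defines "W \<equiv> racah t p q d e f" and "\<nu> \<equiv> of_nat n :: 'a"
  shows "(\<nu> + t) * (\<nu> + e) * (\<nu> + f) * (W (Suc n) - W n)
     - \<nu> * (\<nu> + t - e) * (\<nu> + t - f) * (W n - W (n - 1)) + 2 * p * q * (2*\<nu> + t) * W n = 0"
    (is "?R = 0")
proof -
  have "d \<notin> \<int>\<^sub>\<le>\<^sub>0"
    using nonpole(1) nonpos_Ints_Int by blast
  from racah_recurrence[OF balanced this nonpole(2,3), of n]
  \<comment> \<open>Since \<nu>+t-d = \<nu>+d-1, the general recurrence is exactly this
    product.\<close>
  have "(\<nu> + d - 1) * (\<nu> + d) * (2 * ?R) = 0"
    unfolding W_def[symmetric] \<nu>_def[symmetric] using half by algebra
  moreover have "\<nu> + d \<noteq> 0" "\<nu> + d - 1 \<noteq> 0"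
  proof -
    have "d \<noteq> - \<nu>" "d \<noteq> 1 - \<nu>"
      using nonpole(1) by (auto simp: \<nu>_def)
    then show "\<nu> + d \<noteq> 0" "\<nu> + d - 1 \<noteq> 0"
      by (auto simp: add_eq_0_iff algebra_simps)
  qed
  ultimately show ?thesis
    by (metis mult_eq_0_iff zero_neq_numeral)
qed

section \<open>Power series with a three-term recurrence\<close>

text \<open>The limiting recurrence has the double root 1, and bounding u_(n+2) by the absolute
  values 2 and 1 of the limiting coefficients would give a radius below 1. In the coordinates
  u_(n+1) and u_(n+1) - u_n it is a Jordan block with eigenvalue 1, whose norm comes arbitrarily
  close to 1 once the difference carries a large weight.\<close>

lemma conv_radius_ge_1_if_recurrence:
  fixes u :: "nat \<Rightarrow> 'a :: {banach, real_normed_field}"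
  assumes rec: "\<And>n. u (Suc (Suc n)) = \<alpha> n * u (Suc n) + \<beta> n * u n"
    and \<alpha>: "\<alpha> \<longlonglongrightarrow> 2" and \<beta>: "\<beta> \<longlonglongrightarrow> - 1"
  shows "conv_radius u \<ge> 1"
proof (rule conv_radius_geI_ex')
  fix r :: real assume r: "0 < r" "ereal r < 1"
  \<comment> \<open>Halfway between 1 and 1/r, so that growth by \<open>L\<close> > 1 still leaves
    \<open>L * r\<close> < 1 for the ratio test.\<close>
  define L where "L = (1 + 1 / r) / 2"
  have "1 < 1 / r"
    using r by (simp add: one_ereal_def)
  then have L: "1 < L" "L < 1 / r"
    unfolding L_def by simp_all
  then have Lr: "L * r < 1"
    using r by (simp add: pos_less_divide_eq)
  \<comment> \<open>The weight and the tolerance are chosen for the estimates \<open>1\<close> and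
    \<open>2\<close>, which bound the coefficients of the two norms in \<open>M (Suc n)\<close> by
    \<open>L\<close> and \<open>K * L\<close>.\<close>
  define K where "K = 2 / (L - 1)"
  define \<epsilon> where "\<epsilon> = min ((L - 1) / (L + 1)) ((L - 1)^2 / (L + 1))"
  have K: "K > 0" and \<epsilon>: "\<epsilon> > 0"
    using L by (simp_all add: K_def \<epsilon>_def)
  have "(K + 1) * \<epsilon> \<le> (K + 1) * ((L - 1)^2 / (L + 1))"
    using K by (intro mult_left_mono) (simp_all add: \<epsilon>_def)
  also have "\<dots> = L - 1"
    using L by (simp add: K_def divide_simps power2_eq_square)
  finally have 1: "1 + (K + 1) * \<epsilon> \<le> L"
    by simp
  have "(K + 1) * (1 + \<epsilon>) \<le> (K + 1) * (1 + (L - 1) / (L + 1))"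
    using K by (intro mult_left_mono) (simp_all add: \<epsilon>_def)
  also have "\<dots> = K * L"
    using L by (simp add: K_def divide_simps)
  finally have 2: "(K + 1) * (1 + \<epsilon>) \<le> K * L" .
  have "(\<lambda>n. \<alpha> n + \<beta> n - 1) \<longlonglongrightarrow> 2 + - 1 - 1"
    by (intro tendsto_intros \<alpha> \<beta>)
  then have "\<forall>\<^sub>F n in sequentially. norm (\<alpha> n + \<beta> n - 1) < \<epsilon>"
    using \<epsilon> by (simp add: tendsto_iff)
  moreover have "\<forall>\<^sub>F n in sequentially. norm (\<beta> n - - 1) < \<epsilon>"
    using \<beta> \<epsilon> by (simp add: tendsto_iff dist_norm)
  ultimately have "\<forall>\<^sub>F n in sequentially. norm (\<alpha> n + \<beta> n - 1) \<le> \<epsilon> \<and> norm (\<beta> n) \<le> 1 + \<epsilon>"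
  proof eventually_elim
    case (elim n)
    have "norm (\<beta> n) \<le> norm (\<beta> n - - 1) + norm (- 1 :: 'a)"
      by (metis add.commute norm_triangle_sub)
    with elim show ?case by simp
  qed
  then obtain N where N: "\<And>n. n \<ge> N \<Longrightarrow> norm (\<alpha> n + \<beta> n - 1) \<le> \<epsilon> \<and> norm (\<beta> n) \<le> 1 + \<epsilon>"
    unfolding eventually_sequentially by blast
  define M where "M n = norm (u (Suc n)) + K * norm (u (Suc n) - u n)" for n
  have M: "M (Suc n) \<le> L * M n" if "n \<ge> N" for n
  proof -
    let ?v = "u (Suc n) - u n"
    have v': "u (Suc (Suc n)) - u (Suc n) = (\<alpha> n + \<beta> n - 1) * u (Suc n) - \<beta> n * ?v"
      by (simp add: rec algebra_simps)
    have "norm (u (Suc (Suc n)) - u (Suc n)) \<le> norm ((\<alpha> n + \<beta> n - 1) * u (Suc n)) + norm (\<beta> n * ?v)"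
      unfolding v' by (rule norm_triangle_ineq4)
    also have "\<dots> \<le> \<epsilon> * norm (u (Suc n)) + (1 + \<epsilon>) * norm ?v"
      using N[OF that] by (auto simp: norm_mult intro!: add_mono mult_right_mono)
    finally have *: "norm (u (Suc (Suc n)) - u (Suc n)) \<le> \<epsilon> * norm (u (Suc n)) + (1 + \<epsilon>) * norm ?v" .
    have "M (Suc n) \<le> norm (u (Suc n)) + (K + 1) * norm (u (Suc (Suc n)) - u (Suc n))"
      unfolding M_def using norm_triangle_sub[of "u (Suc (Suc n))" "u (Suc n)"]
      by (simp add: algebra_simps)
    also have "\<dots> \<le> norm (u (Suc n)) + (K + 1) * (\<epsilon> * norm (u (Suc n)) + (1 + \<epsilon>) * norm ?v)"
      using K * by (intro add_left_mono mult_left_mono) auto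
    also have "\<dots> = (1 + (K + 1) * \<epsilon>) * norm (u (Suc n)) + ((K + 1) * (1 + \<epsilon>)) * norm ?v"
      by (simp add: algebra_simps)
    also have "\<dots> \<le> L * norm (u (Suc n)) + (K * L) * norm ?v"
      using 1 2 by (intro add_mono mult_right_mono) auto
    also have "\<dots> = L * M n"
      by (simp add: M_def algebra_simps)
    finally show ?thesis .
  qed
  have M_nonneg: "M n \<ge> 0" for n
    using K by (simp add: M_def)
  have "summable (\<lambda>n. M n * r ^ n)"
  proof (rule summable_ratio_test[OF Lr])
    fix n assume "n \<ge> N"
    then have "M (Suc n) * r ^ Suc n \<le> (L * M n) * r ^ Suc n"
      using r by (intro mult_right_mono M) auto
    then show "norm (M (Suc n) * r ^ Suc n) \<le> L * r * norm (M n * r ^ n)"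
      using r M_nonneg by (simp add: abs_mult mult_ac)
  qed
  then have "summable (\<lambda>n. r * (M n * r ^ n))"
    by (rule summable_mult)
  moreover have "norm (u (Suc n) * of_real r ^ Suc n) \<le> r * (M n * r ^ n)" for n
  proof -
    have "norm (u (Suc n)) * (r * r ^ n) \<le> M n * (r * r ^ n)"
      using r K by (intro mult_right_mono) (simp_all add: M_def)
    then show ?thesis
      using r by (simp add: norm_mult norm_power mult_ac)
  qed
  ultimately have "summable (\<lambda>n. u (Suc n) * of_real r ^ Suc n)"
    by (rule summable_comparison_test'[where N = 0])
  then show "summable (\<lambda>n. u n * of_real r ^ n)"
    by (rule summable_Suc_iff[THEN iffD1])
qed

text \<open>Once the leading power of X is split off, the cofactor is nonzero near 0, so zeros
  cannot accumulate there. Frequent zeros are assumed, because the equation is known only off the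
  cut.\<close>

lemma has_fps_expansion_eq_0:
  fixes F :: "'a :: {banach, real_normed_field} fps"
  assumes "f has_fps_expansion F" "\<exists>\<^sub>F z in at 0. f z = 0"
  shows "F = 0"
proof (rule ccontr)
  assume "F \<noteq> 0"
  define n where "n = subdegree F"
  have radius: "fps_conv_radius F > 0" and eval: "\<forall>\<^sub>F z in nhds 0. eval_fps F z = f z"
    using assms(1) by (auto simp: has_fps_expansion_def)
  let ?G = "fps_shift n F"
  have "fps_nth ?G 0 \<noteq> 0"
    using \<open>F \<noteq> 0\<close> by (simp add: n_def)
  moreover have "isCont (eval_fps ?G) 0"
    using radius by (intro continuous_eval_fps) (simp add: zero_ereal_def)
  ultimately have "\<forall>\<^sub>F z in at 0. eval_fps ?G z \<noteq> 0"
    by (intro tendsto_imp_eventually_ne[of _ "eval_fps ?G 0"]) (auto simp: isCont_def eval_fps_at_0)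
  moreover have "\<forall>\<^sub>F z in at 0. z \<in> eball 0 (fps_conv_radius F)"
    using radius by (intro eventually_at_in_open'[OF open_eball]) (simp add: zero_ereal_def)
  moreover have "\<forall>\<^sub>F z in at 0. eval_fps F z = f z"
    using eval by (simp add: eventually_nhds_conv_at)
  moreover have "\<forall>\<^sub>F z in at 0. z \<noteq> (0 :: 'a)"
    by (simp add: eventually_at_filter)
  ultimately have "\<forall>\<^sub>F z in at 0. f z \<noteq> 0"
  proof eventually_elim
    case (elim z)
    then show ?case
      using eval_fps_shift[of n F z] by (auto simp: n_def)
  qed
  with assms(2) show False
    by (simp add: frequently_def)
qed

section \<open>The Dotsenko--Fateev equation\<close>

lemma has_field_derivative_powr_mult_eval_fps:
  fixes F :: "complex fps"
  assumes "z \<notin> \<real>\<^sub>\<le>\<^sub>0" "norm z < fps_conv_radius F"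
  shows "((\<lambda>w. w powr \<rho> * eval_fps F w) has_field_derivative
    z powr (\<rho> - 1) * eval_fps (euler_op \<rho> F) z) (at z)"
proof -
  have z: "z \<noteq> 0" and "z powr 1 = z"
    using assms(1) by (auto simp: powr_def)
  then have powr: "z powr \<rho> = z powr (\<rho> - 1) * z"
    by (simp add: powr_diff)
  have F': "norm z < fps_conv_radius (fps_deriv F)"
    using assms(2) fps_conv_radius_deriv[of F] by (rule less_le_trans)
  have "norm z < fps_conv_radius (fps_X * fps_deriv F)" "norm z < fps_conv_radius (fps_const \<rho> * F)"
    using assms(2) F' by (intro less_le_trans[OF _ fps_conv_radius_mult]; simp)+
  then have "eval_fps (euler_op \<rho> F) z = z * eval_fps (fps_deriv F) z + \<rho> * eval_fps F z"
    using assms(2) F' by (simp add: euler_op_def eval_fps_add eval_fps_mult)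
  moreover have "((\<lambda>w. w powr \<rho> * eval_fps F w) has_field_derivative
      \<rho> * z powr (\<rho> - 1) * eval_fps F z + eval_fps (fps_deriv F) z * z powr \<rho>) (at z)"
    by (intro DERIV_mult has_field_derivative_powr has_field_derivative_eval_fps assms)
  ultimately show ?thesis
    by (simp add: powr algebra_simps)
qed

lemma fps_conv_radius_euler_op:
  fixes F :: "complex fps"
  shows "fps_conv_radius (euler_op \<rho> F) \<ge> fps_conv_radius F"
proof -
  have "fps_conv_radius (fps_X * fps_deriv F) \<ge> fps_conv_radius F"
    using fps_conv_radius_mult[of fps_X "fps_deriv F"] fps_conv_radius_deriv[of F] by simp
  moreover have "fps_conv_radius (fps_const \<rho> * F) \<ge> fps_conv_radius F"
    using fps_conv_radius_mult[of "fps_const \<rho>" F] by simp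
  ultimately show ?thesis
    unfolding euler_op_def
    using fps_conv_radius_add[of "fps_X * fps_deriv F" "fps_const \<rho> * F"]
    by (meson min.boundedI order_trans)
qed

text \<open>Hypothesis and conclusion are equalities near z of the same shape, so the lemma iterates
  to higher derivatives.\<close>

lemma deriv_powr_mult_eval_fps:
  fixes F :: "complex fps"
  assumes "z \<notin> \<real>\<^sub>\<le>\<^sub>0" "norm z < fps_conv_radius F"
    and "\<forall>\<^sub>F w in nhds z. f w = w powr \<rho> * eval_fps F w"
  shows "\<forall>\<^sub>F w in nhds z. deriv f w = w powr (\<rho> - 1) * eval_fps (euler_op \<rho> F) w"
proof -
  have "open (eball (0 :: complex) (fps_conv_radius F) - \<real>\<^sub>\<le>\<^sub>0)"
    by (intro open_Diff open_eball closed_nonpos_Reals_complex)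
  then have "\<forall>\<^sub>F w in nhds z. w \<in> eball 0 (fps_conv_radius F) - \<real>\<^sub>\<le>\<^sub>0"
    using assms by (intro eventually_nhds_in_open) auto
  moreover have "\<forall>\<^sub>F w in nhds z. \<forall>\<^sub>F v in nhds w. f v = v powr \<rho> * eval_fps F v"
    using assms(3) by (simp add: eventually_eventually)
  ultimately show ?thesis
  proof eventually_elim
    case (elim w)
    then have "deriv f w = deriv (\<lambda>w. w powr \<rho> * eval_fps F w) w"
      by (intro deriv_cong_ev) auto
    also have "\<dots> = w powr (\<rho> - 1) * eval_fps (euler_op \<rho> F) w"
      using elim by (intro DERIV_imp_deriv has_field_derivative_powr_mult_eval_fps) auto
    finally show ?case .
  qed
qed

text \<open>
  \<open>DF_fps_op a b c g \<rho>\<close> is $x \cdot x^{-\rho} S(a,b,c,g)\, x^{\rho}$ acting on power series, written through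
  $x\,d/dx$: \<open>euler_op \<rho>\<close> is the conjugate of $x\,d/dx$ by $x^{\rho}$.
\<close>

definition DF_fps_op :: "complex \<Rightarrow> complex \<Rightarrow> complex \<Rightarrow> complex \<Rightarrow> complex \<Rightarrow> complex fps \<Rightarrow> complex fps" where
  "DF_fps_op a b c g \<rho> F = (let T = euler_op \<rho>; x = fps_X;
     a = fps_const a; b = fps_const b; c = fps_const c; g = fps_const g in
     (1 - x)^2 * (T (T (T F)) - 3 * T (T F) + 2 * T F)
     + (1 - x) * ((3*a + 3*b + 6*c + 2*g) * x - (3*a + 3*c + g)) * (T (T F) - T F)
     + (2*a^2*x^2 + 4*a*b*x^2 + 12*a*c*x^2 + 3*a*g*x^2 + 2*b^2*x^2 + 12*b*c*x^2
        + 3*b*g*x^2 + 12*c^2*x^2 + 8*c*g*x^2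
        + g^2*x^2 - 4*a^2*x - 4*a*b*x - 16*a*c*x - 4*a*g*x + a*x^2 - 8*b*c*x - 2*b*g*x
        + b*x^2 - 12*c^2*x - 8*c*g*x + 6*c*x^2
        - g^2*x + g*x^2 + 2*a^2 + 4*a*c + a*g - 2*a*x + 2*c^2 + c*g - 6*c*x - g*x + a + c) * T F
     + x * (- c * (2*a + 2 + 2*b + 2*c + g)
         * (2*a*x + 2*b*x + 4*c*x + 2*g*x - 2*a - 2*c - g + 2*x - 1)) * F)"

text \<open>With \<theta> = x d/dx, the k-th derivative times x^k is
  \<theta>(\<theta>-1)...(\<theta>-k+1), and \<theta> acts on x^\<rho> F as
  \<open>euler_op \<rho>\<close> on F. The extra factor z supplies the missing power of x.\<close>

lemma DF_operator_powr_mult_eval_fps: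
  fixes \<rho> :: complex
  assumes "z \<notin> \<real>\<^sub>\<le>\<^sub>0" "norm z < fps_conv_radius F"
  defines "T \<equiv> euler_op \<rho>"
  shows "z * DF_operator a b c g (\<lambda>w. w powr \<rho> * eval_fps F w) z = z powr \<rho> *
     ((1 - z)^2 * (eval_fps (T (T (T F))) z - 3 * eval_fps (T (T F)) z + 2 * eval_fps (T F) z)
     + (1 - z) * ((3*a + 3*b + 6*c + 2*g) * z - (3*a + 3*c + g)) * (eval_fps (T (T F)) z - eval_fps (T F) z)
     + DF_s2 a b c g z * eval_fps (T F) z + z * DF_s3 a b c g z * eval_fps F z)"
proof -
  let ?f = "\<lambda>w. w powr \<rho> * eval_fps F w"
  let ?F1 = "T F" and ?F2 = "T (T F) - T F" and ?F3 = "T (T (T F)) - 3 * T (T F) + 2 * T F"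
  have z: "z \<noteq> 0" and "z powr 1 = z"
    using assms(1) by (auto simp: powr_def)
  then have powr: "z powr \<sigma> = z powr (\<sigma> - 1) * z" for \<sigma>
    by (simp add: powr_diff)
  \<comment> \<open>Everything is expressed through the lowest power that occurs, that of the third
    derivative.\<close>
  have powr2: "z powr (\<rho> - 1) = z powr (\<rho> - 3) * z^2" "z powr (\<rho> - 2) = z powr (\<rho> - 3) * z"
    "z powr \<rho> = z powr (\<rho> - 3) * z^3"
    using powr[of \<rho>] powr[of "\<rho> - 1"] powr[of "\<rho> - 2"] by (simp_all add: power2_eq_square power3_eq_cube)
  have F2: "euler_op (\<rho> - 1) ?F1 = ?F2"
    using euler_op_shift[of \<rho> "- 1" "T F"] by (simp add: T_def flip: fps_const_neg)
  have F3: "euler_op (\<rho> - 2) ?F2 = ?F3"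
  proof -
    have "euler_op (\<rho> - 2) ?F2 = T ?F2 - 2 * ?F2"
      using euler_op_shift[of \<rho> "- 2" ?F2] by (simp add: T_def numeral_fps_const flip: fps_const_neg)
    then show ?thesis
      by (simp add: T_def euler_op_diff algebra_simps)
  qed
  have step: "norm z < fps_conv_radius (euler_op \<sigma> G)" if "norm z < fps_conv_radius G" for \<sigma> and G :: "complex fps"
    by (rule less_le_trans[OF that fps_conv_radius_euler_op])
  note radius = assms(2) step[OF assms(2), of \<rho>, folded T_def]
    step[OF step[OF assms(2), of \<rho>], of \<rho>, folded T_def]
    step[OF step[OF step[OF assms(2), of \<rho>], of \<rho>], of \<rho>, folded T_def]
  have radius2: "norm z < fps_conv_radius ?F2"
    using step[OF radius(2)] unfolding F2[symmetric] .
  have "\<forall>\<^sub>F w in nhds z. ?f w = w powr \<rho> * eval_fps F w"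
    by simp
  from deriv_powr_mult_eval_fps[OF assms(1,2) this]
  have 1: "\<forall>\<^sub>F w in nhds z. deriv ?f w = w powr (\<rho> - 1) * eval_fps ?F1 w"
    by (simp add: T_def)
  from deriv_powr_mult_eval_fps[OF assms(1) radius(2) this]
  have 2: "\<forall>\<^sub>F w in nhds z. (deriv ^^ 2) ?f w = w powr (\<rho> - 2) * eval_fps ?F2 w"
    by (simp add: F2 numeral_2_eq_2)
  from deriv_powr_mult_eval_fps[OF assms(1) radius2 this]
  have 3: "\<forall>\<^sub>F w in nhds z. (deriv ^^ 3) ?f w = w powr (\<rho> - 3) * eval_fps ?F3 w"
    by (simp add: F3 numeral_3_eq_3 numeral_2_eq_2)
  have mult: "norm z < fps_conv_radius (numeral m * G)" if "norm z < fps_conv_radius G" for m and G :: "complex fps"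
    by (rule less_le_trans[OF _ fps_conv_radius_mult]) (simp add: that)
  have sub: "norm z < fps_conv_radius (G - H)"
    if "norm z < fps_conv_radius G" "norm z < fps_conv_radius H" for G H :: "complex fps"
    by (rule less_le_trans[OF _ fps_conv_radius_diff]) (simp add: that)
  have e2: "eval_fps ?F2 z = eval_fps (T (T F)) z - eval_fps (T F) z"
    using radius by (simp add: eval_fps_diff)
  have e3: "eval_fps ?F3 z = eval_fps (T (T (T F))) z - 3 * eval_fps (T (T F)) z + 2 * eval_fps (T F) z"
    using radius by (simp add: eval_fps_diff eval_fps_add eval_fps_mult mult sub)
  show ?thesis
    unfolding DF_operator_def eventually_nhds_x_imp_x[OF 1] eventually_nhds_x_imp_x[OF 2]
      eventually_nhds_x_imp_x[OF 3] e2 e3 powr2 DF_s1_def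
    by algebra
qed

text \<open>The factor beside \<open>z powr \<rho>\<close> in the preceding identity is analytic in
  a full neighbourhood of 0, across the cut, so it can be compared with a formal series.\<close>

lemma DF_fps_op_has_fps_expansion:
  fixes \<rho> :: complex
  assumes "fps_conv_radius F > 0"
  defines "T \<equiv> euler_op \<rho>"
  shows "(\<lambda>z. (1 - z)^2 * (eval_fps (T (T (T F))) z - 3 * eval_fps (T (T F)) z + 2 * eval_fps (T F) z)
     + (1 - z) * ((3*a + 3*b + 6*c + 2*g) * z - (3*a + 3*c + g)) * (eval_fps (T (T F)) z - eval_fps (T F) z)
     + DF_s2 a b c g z * eval_fps (T F) z + z * DF_s3 a b c g z * eval_fps F z)
    has_fps_expansion DF_fps_op a b c g \<rho> F"
proof -
  have "fps_conv_radius (T G) > 0" if "fps_conv_radius G > 0" for G :: "complex fps"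
    unfolding T_def by (rule less_le_trans[OF that fps_conv_radius_euler_op])
  then have "eval_fps (T (T (T F))) has_fps_expansion T (T (T F))"
    "eval_fps (T (T F)) has_fps_expansion T (T F)" "eval_fps (T F) has_fps_expansion T F"
    "eval_fps F has_fps_expansion F"
    using assms(1) by (simp_all add: eval_fps_has_fps_expansion)
  note intros = has_fps_expansion_add has_fps_expansion_diff has_fps_expansion_mult
    has_fps_expansion_minus this has_fps_expansion_fps_X has_fps_expansion_1
    has_fps_expansion_numeral has_fps_expansion_const
  show ?thesis
    unfolding DF_s2_def DF_s3_def power2_eq_square
    by (rule has_fps_expansion_schematicI, (rule intros)+)
      (simp only: DF_fps_op_def Let_def T_def power2_eq_square)
qed

text \<open>Off the cut neither z nor \<open>z powr \<rho>\<close> vanishes, so the differential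
  equation says that the analytic factor \<open>e\<close> is 0 there. These points accumulate at 0,
  which forces the expansion of \<open>e\<close> to be zero.\<close>

lemma DF_normalized_series_iff:
  "DF_normalized_series a b c g \<rho> F \<longleftrightarrow>
     fps_nth F 0 = 1 \<and> fps_conv_radius F > 0 \<and> DF_fps_op a b c g \<rho> F = 0"
proof (cases "fps_conv_radius F > 0")
  case True
  define T where "T = euler_op \<rho>"
  define e where "e z = (1 - z)^2 * (eval_fps (T (T (T F))) z - 3 * eval_fps (T (T F)) z + 2 * eval_fps (T F) z)
     + (1 - z) * ((3*a + 3*b + 6*c + 2*g) * z - (3*a + 3*c + g)) * (eval_fps (T (T F)) z - eval_fps (T F) z)
     + DF_s2 a b c g z * eval_fps (T F) z + z * DF_s3 a b c g z * eval_fps F z" for z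
  have expansion: "e has_fps_expansion DF_fps_op a b c g \<rho> F"
    unfolding e_def[abs_def] T_def by (rule DF_fps_op_has_fps_expansion[OF True])
  let ?at = "at 0 within (- \<real>\<^sub>\<le>\<^sub>0 :: complex set)"
  have "\<forall>\<^sub>F z in at 0. z \<in> eball 0 (fps_conv_radius F)"
    by (rule eventually_at_in_open'[OF open_eball]) (use True in \<open>simp add: zero_ereal_def\<close>)
  then have "\<forall>\<^sub>F z in ?at. z \<in> eball 0 (fps_conv_radius F)"
    by (rule filter_leD[OF at_le[OF subset_UNIV]])
  moreover have "\<forall>\<^sub>F z in ?at. z \<notin> \<real>\<^sub>\<le>\<^sub>0"
    by (auto simp: eventually_at_filter)
  ultimately have "\<forall>\<^sub>F z in ?at.
      DF_operator a b c g (\<lambda>w. w powr \<rho> * eval_fps F w) z = 0 \<longleftrightarrow> e z = 0"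
  proof eventually_elim
    case (elim z)
    then have "z \<noteq> 0" by auto
    with elim DF_operator_powr_mult_eval_fps[of z F a b c g \<rho>] show ?case
      by (auto simp: e_def T_def)
  qed
  then have "(\<forall>\<^sub>F z in ?at. DF_operator a b c g (\<lambda>w. w powr \<rho> * eval_fps F w) z = 0) \<longleftrightarrow>
      (\<forall>\<^sub>F z in ?at. e z = 0)"
    by (rule eventually_subst)
  also have "\<dots> \<longleftrightarrow> DF_fps_op a b c g \<rho> F = 0"
  proof
    assume *: "\<forall>\<^sub>F z in ?at. e z = 0"
    \<comment> \<open>Otherwise the filter would be trivial and an eventual statement would carry no
      information.\<close>
    have "(0 :: complex) islimpt - \<real>\<^sub>\<le>\<^sub>0"
    proof (rule islimpt_sequential[THEN iffD2], intro exI conjI allI)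
      show "(\<lambda>n. complex_of_real (inverse (real (Suc n)))) \<longlonglongrightarrow> 0"
        using tendsto_of_real[OF LIMSEQ_inverse_real_of_nat, where ?'a = complex] by simp
      show "complex_of_real (inverse (real (Suc n))) \<in> - \<real>\<^sub>\<le>\<^sub>0 - {0}" for n
        by (simp del: of_nat_Suc of_real_inverse add: complex_nonpos_Reals_iff)
    qed
    then have "?at \<noteq> bot"
      by (simp add: trivial_limit_within)
    with * have "\<exists>\<^sub>F z in ?at. e z = 0"
      by (rule eventually_frequently[rotated])
    then have "\<exists>\<^sub>F z in at 0. e z = 0"
      unfolding frequently_def using filter_leD[OF at_le[OF subset_UNIV]] by blast
    with expansion show "DF_fps_op a b c g \<rho> F = 0"
      by (rule has_fps_expansion_eq_0)
  next
    assume "DF_fps_op a b c g \<rho> F = 0"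
    then have "\<forall>\<^sub>F z in nhds 0. e z = 0"
      using expansion by (auto simp: has_fps_expansion_def elim: eventually_mono)
    then show "\<forall>\<^sub>F z in ?at. e z = 0"
      by (auto simp: eventually_at_filter elim: eventually_mono)
  qed
  finally show ?thesis
    using True by (simp add: DF_normalized_series_def)
qed (simp add: DF_normalized_series_def)

section \<open>Conjugation of the equation to the three-term recurrence\<close>

definition DF_R0 :: "complex \<Rightarrow> complex \<Rightarrow> complex \<Rightarrow> complex \<Rightarrow> complex \<Rightarrow> complex" where
  "DF_R0 a b c g m = m * (m - 1 - a - c) * (m - 2 - 2*a - 2*c - g)"

text \<open>\<open>DF_R0\<close> is the indicial polynomial in m = \<rho> + n. \<open>DF_R1\<close>
  is arranged to display, at \<rho> = 0, the Racah recurrence: its two products are the forward and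
  backward coefficients, and its last line comes from the term with p q.\<close>

definition DF_R1 :: "complex \<Rightarrow> complex \<Rightarrow> complex \<Rightarrow> complex \<Rightarrow> complex \<Rightarrow> complex" where
  "DF_R1 a b c g m =
     (m - 2*a - 2*c - g - 1) * (m - a - c) * (m + b - c + 1)
     + m * (m - a - c - g - 1) * (m - 2*a - b - c - g - 2)
     + c * (2*b + 2 + g) * (2*m - 2*a - 2*c - g - 1)"

definition DF_R2 :: "complex \<Rightarrow> complex \<Rightarrow> complex \<Rightarrow> complex \<Rightarrow> complex \<Rightarrow> complex" where
  "DF_R2 a b c g m = (m + b - c + 1) * (m - a - c - g) * (m - 2*a - b - c - g - 1)"

text \<open>
  Conjugating by $(1-x)^{b+c+1}$ shifts the exponents at $x = 1$ to $-(b+c+1), 0, b+c+g+1$. Since \<open>0\<close>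
  remains an exponent, a factor $1 - x$ cancels and a three-term recurrence for the coefficients is left.
\<close>

definition DF_rec_op :: "complex \<Rightarrow> complex \<Rightarrow> complex \<Rightarrow> complex \<Rightarrow> complex \<Rightarrow> complex fps \<Rightarrow> complex fps" where
  "DF_rec_op a b c g \<rho> H = (let T = \<lambda>\<sigma>. euler_op (\<rho> + \<sigma>) in
     T 0 (T (- 1 - a - c) (T (- 2 - 2*a - 2*c - g) H))
     - fps_X * (T (- 2*a - 2*c - g - 1) (T (- a - c) (T (b - c + 1) H))
       + T 0 (T (- a - c - g - 1) (T (- 2*a - b - c - g - 2) H))
       + fps_const (c * (2*b + 2 + g)) * (2 * T 0 H - fps_const (2*a + 2*c + g + 1) * H))
     + fps_X^2 * T (b - c + 1) (T (- a - c - g) (T (- 2*a - b - c - g - 1) H)))"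

lemma DF_rec_op_nth:
  "fps_nth (DF_rec_op a b c g \<rho> H) n = DF_R0 a b c g (\<rho> + of_nat n) * fps_nth H n
     - (case n of 0 \<Rightarrow> 0 | Suc k \<Rightarrow> DF_R1 a b c g (\<rho> + of_nat k) * fps_nth H k)
     + (case n of Suc (Suc k) \<Rightarrow> DF_R2 a b c g (\<rho> + of_nat k) * fps_nth H k | _ \<Rightarrow> 0)"
proof -
  have two: "2 * G = fps_const 2 * G" for G :: "complex fps"
    by (simp flip: numeral_fps_const)
  consider "n = 0" | "n = 1" | k where "n = Suc (Suc k)"
    by (metis One_nat_def not0_implies_Suc)
  then show ?thesis
    by cases (simp_all add: DF_rec_op_def Let_def DF_R0_def DF_R1_def DF_R2_def
        power2_eq_square two mult.assoc, simp_all add: algebra_simps)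
qed

lemma euler_op_shift3:
  fixes H :: "'a::comm_ring_1 fps" and \<rho> :: 'a
  defines "T \<equiv> euler_op \<rho>"
  shows "euler_op (\<rho> + k) (euler_op (\<rho> + l) (euler_op (\<rho> + m) H)) =
    T (T (T H)) + (fps_const k + fps_const l + fps_const m) * T (T H)
    + (fps_const k * fps_const l + fps_const k * fps_const m + fps_const l * fps_const m) * T H
    + fps_const k * fps_const l * fps_const m * H"
  unfolding T_def euler_op_shift euler_op_add euler_op_const_mult
  by (simp only: algebra_simps)

lemma DF_fps_op_powr_mult:
  fixes b c :: complex
  defines "P \<equiv> fps_one_minus_powr (1 + b + c)"
  shows "DF_fps_op a b c g \<rho> (P * H) = P * DF_rec_op a b c g \<rho> H"
proof -
  \<comment> \<open>Abstract names for the constants and for the Euler derivatives of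
    \<open>H\<close>, so that the claim becomes a polynomial identity in a commutative ring.\<close>
  define A B C G where "A = fps_const a" "B = fps_const b" "C = fps_const c" "G = fps_const g"
  define K1 where "K1 = euler_op \<rho> H"
  define K2 where "K2 = euler_op \<rho> K1"
  define K3 where "K3 = euler_op \<rho> K2"
  note K_defs = K1_def K2_def K3_def
  have S: "fps_const (1 + b + c) = 1 + B + C"
    by (simp add: A_B_C_G_def flip: fps_const_add)
  let ?\<tau> = "(3*A + 3*B + 6*C + 2*G) * fps_X - (3*A + 3*C + G)"
  let ?s2 = "2*A^2*fps_X^2 + 4*A*B*fps_X^2 + 12*A*C*fps_X^2 + 3*A*G*fps_X^2 + 2*B^2*fps_X^2 + 12*B*C*fps_X^2
        + 3*B*G*fps_X^2 + 12*C^2*fps_X^2 + 8*C*G*fps_X^2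
        + G^2*fps_X^2 - 4*A^2*fps_X - 4*A*B*fps_X - 16*A*C*fps_X - 4*A*G*fps_X + A*fps_X^2 - 8*B*C*fps_X - 2*B*G*fps_X
        + B*fps_X^2 - 12*C^2*fps_X - 8*C*G*fps_X + 6*C*fps_X^2
        - G^2*fps_X + G*fps_X^2 + 2*A^2 + 4*A*C + A*G - 2*A*fps_X + 2*C^2 + C*G - 6*C*fps_X - G*fps_X + A + C"
  let ?s3 = "- C * (2*A + 2 + 2*B + 2*C + G)
         * (2*A*fps_X + 2*B*fps_X + 4*C*fps_X + 2*G*fps_X - 2*A - 2*C - G + 2*fps_X - 1)"
  let ?T1 = "euler_op \<rho> (P * H)" let ?T2 = "euler_op \<rho> ?T1" let ?T3 = "euler_op \<rho> ?T2"
  have two: "fps_const 2 = (2 :: complex fps)"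
    by (simp add: numeral_fps_const)
  have const_eqs: "fps_const (- 1 - a - c) = - 1 - A - C"
    "fps_const (- 2 - 2*a - 2*c - g) = - 2 - 2*A - 2*C - G"
    "fps_const (- 2*a - 2*c - g - 1) = - 2*A - 2*C - G - 1"
    "fps_const (- a - c) = - A - C" "fps_const (b - c + 1) = B - C + 1"
    "fps_const (- a - c - g - 1) = - A - C - G - 1"
    "fps_const (- 2*a - b - c - g - 2) = - 2*A - B - C - G - 2"
    "fps_const (c * (2*b + 2 + g)) = C * (2*B + 2 + G)"
    "fps_const (2*a + 2*c + g + 1) = 2*A + 2*C + G + 1"
    "fps_const (- a - c - g) = - A - C - G"
    "fps_const (- 2*a - b - c - g - 1) = - 2*A - B - C - G - 1"
    by (simp_all add: A_B_C_G_def two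
        flip: fps_const_add fps_const_sub fps_const_neg fps_const_mult)
  have M: "DF_rec_op a b c g \<rho> H =
     (K3 + (- 3 - 3*A - 3*C - G) * K2 + (1 + A + C) * (2 + 2*A + 2*C + G) * K1)
     - fps_X * ((K3 + (- 3*A + B - 4*C - G) * K2
         + ((2*A + 2*C + G + 1) * (A + C) - (3*A + 3*C + G + 1) * (B - C + 1)) * K1
         + (2*A + 2*C + G + 1) * (A + C) * (B - C + 1) * H)
       + (K3 + (- 3*A - B - 2*C - 2*G - 3) * K2 + (A + C + G + 1) * (2*A + B + C + G + 2) * K1)
       + C * (2*B + 2 + G) * (2 * K1 - (2*A + 2*C + G + 1) * H))
     + fps_X^2 * (K3 + (- 3*A - 3*C - 2*G) * K2
       + ((A + C + G) * (2*A + B + C + G + 1) - (B - C + 1) * (3*A + B + 2*C + 2*G + 1)) * K1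
       + (B - C + 1) * (A + C + G) * (2*A + B + C + G + 1) * H)"
    unfolding DF_rec_op_def Let_def euler_op_shift3 const_eqs
    unfolding fps_const_0_eq_0 add_0_right K_defs[symmetric]
    by algebra
  \<comment> \<open>One more factor 1 - X provides the cube needed by the third-order rule; the same
    factor comes out on the other side and cancels.\<close>
  have "(1 - fps_X) * DF_fps_op a b c g \<rho> (P * H) =
      (1 - fps_X)^3 * ?T3 + (?\<tau> - 3 * (1 - fps_X)) * ((1 - fps_X)^2 * ?T2)
      + (2 * (1 - fps_X)^2 - (1 - fps_X) * ?\<tau> + ?s2) * ((1 - fps_X) * ?T1)
      + (1 - fps_X) * fps_X * ?s3 * (P * H)"
    unfolding DF_fps_op_def Let_def A_B_C_G_def[symmetric] by algebra
  also have "\<dots> = (1 - fps_X) * (P * DF_rec_op a b c g \<rho> H)"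
    unfolding P_def euler_op_powr_mult euler_op2_powr_mult euler_op3_powr_mult S M
    unfolding P_def[symmetric] K_defs[symmetric]
    by algebra
  finally show ?thesis
    using one_minus_fps_X_neq_0 by simp
qed

section \<open>Existence, uniqueness and convergence of the normalized solutions\<close>

definition DF_recurrence :: "complex \<Rightarrow> complex \<Rightarrow> complex \<Rightarrow> complex \<Rightarrow> complex \<Rightarrow> (nat \<Rightarrow> complex) \<Rightarrow> bool" where
  "DF_recurrence a b c g \<rho> u \<longleftrightarrow>
     DF_R0 a b c g (\<rho> + 1) * u 1 = DF_R1 a b c g \<rho> * u 0 \<and>
     (\<forall>n. DF_R0 a b c g (\<rho> + of_nat (Suc (Suc n))) * u (Suc (Suc n)) =
        DF_R1 a b c g (\<rho> + of_nat (Suc n)) * u (Suc n) - DF_R2 a b c g (\<rho> + of_nat n) * u n)"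

text \<open>The coefficient of X^0 is the indicial polynomial at \<rho> times the constant term,
  hence 0 at an exponent; the further coefficients are the recurrence.\<close>

lemma DF_rec_op_eq_0_iff:
  assumes "DF_R0 a b c g \<rho> = 0"
  shows "DF_rec_op a b c g \<rho> H = 0 \<longleftrightarrow> DF_recurrence a b c g \<rho> (fps_nth H)"
proof -
  have split: "(\<forall>n. Q n) \<longleftrightarrow> Q 0 \<and> Q (Suc 0) \<and> (\<forall>n. Q (Suc (Suc n)))" for Q :: "nat \<Rightarrow> bool"
    by (metis not0_implies_Suc)
  show ?thesis
    unfolding fps_eq_iff DF_recurrence_def
    by (subst split) (simp add: DF_rec_op_nth assms algebra_simps)
qed

lemma DF_recurrence_unique:
  assumes "DF_recurrence a b c g \<rho> u" "DF_recurrence a b c g \<rho> v" "u 0 = v 0"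
    and "\<And>n. DF_R0 a b c g (\<rho> + of_nat (Suc n)) \<noteq> 0"
  shows "u = v"
proof -
  have "u n = v n \<and> u (Suc n) = v (Suc n)" for n
  proof (induction n)
    case 0
    have "DF_R0 a b c g (\<rho> + 1) * u 1 = DF_R0 a b c g (\<rho> + 1) * v 1"
      using assms(1-3) by (simp add: DF_recurrence_def)
    then show ?case
      using assms(3) assms(4)[of 0] by simp
  next
    case (Suc n)
    have "DF_R0 a b c g (\<rho> + of_nat (Suc (Suc n))) * u (Suc (Suc n)) =
        DF_R0 a b c g (\<rho> + of_nat (Suc (Suc n))) * v (Suc (Suc n))"
      using assms(1,2) Suc by (simp only: DF_recurrence_def)
    then show ?case
      using Suc assms(4)[of "Suc n"] by simp
  qed
  then show ?thesis by auto
qed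

fun DF_coeff :: "complex \<Rightarrow> complex \<Rightarrow> complex \<Rightarrow> complex \<Rightarrow> complex \<Rightarrow> nat \<Rightarrow> complex" where
  "DF_coeff a b c g \<rho> 0 = 1"
| "DF_coeff a b c g \<rho> (Suc 0) = DF_R1 a b c g \<rho> / DF_R0 a b c g (\<rho> + 1)"
| "DF_coeff a b c g \<rho> (Suc (Suc n)) =
     (DF_R1 a b c g (\<rho> + of_nat (Suc n)) * DF_coeff a b c g \<rho> (Suc n)
      - DF_R2 a b c g (\<rho> + of_nat n) * DF_coeff a b c g \<rho> n) /
     DF_R0 a b c g (\<rho> + of_nat (Suc (Suc n)))"

lemma DF_recurrence_DF_coeff:
  assumes "\<And>n. DF_R0 a b c g (\<rho> + of_nat (Suc n)) \<noteq> 0"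
  shows "DF_recurrence a b c g \<rho> (DF_coeff a b c g \<rho>)"
proof -
  have "DF_R0 a b c g (\<rho> + 1) \<noteq> 0"
    using assms[of 0] by simp
  then show ?thesis
    unfolding DF_recurrence_def One_nat_def DF_coeff.simps
    by (simp only: times_divide_eq_right nonzero_mult_div_cancel_left assms not_False_eq_True mult_1_right simp_thms)
qed

lemma tendsto_add_of_nat_divide:
  "(\<lambda>n. (of_nat n + z) / of_nat n) \<longlonglongrightarrow> (1 :: complex)"
proof -
  have "(\<lambda>n. 1 + z * (1 / of_nat n)) \<longlonglongrightarrow> 1 + z * 0"
    by (intro tendsto_intros lim_1_over_n)
  moreover have "\<forall>\<^sub>F n in sequentially. 1 + z * (1 / of_nat n) = (of_nat n + z) / of_nat n"
    using eventually_gt_at_top[of 0] by eventually_elim (simp add: add_divide_distrib)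
  ultimately show ?thesis
    using tendsto_cong by fastforce
qed

lemma DF_R_tendsto:
  shows "(\<lambda>n. DF_R0 a b c g (\<rho> + of_nat n) / of_nat n ^ 3) \<longlonglongrightarrow> 1"
    and "(\<lambda>n. DF_R1 a b c g (\<rho> + of_nat n) / of_nat n ^ 3) \<longlonglongrightarrow> 2"
    and "(\<lambda>n. DF_R2 a b c g (\<rho> + of_nat n) / of_nat n ^ 3) \<longlonglongrightarrow> 1"
proof -
  define L where "L z n = (of_nat n + z) / of_nat n" for z :: complex and n :: nat
  have L: "L z \<longlonglongrightarrow> 1" for z
    unfolding L_def by (rule tendsto_add_of_nat_divide)
  have L3: "(\<lambda>n. L x n * L y n * L z n) \<longlonglongrightarrow> 1" for x y z
    using tendsto_mult[OF tendsto_mult[OF L L] L, of x y z] by simp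
  have split: "((\<rho> + of_nat n + x) * (\<rho> + of_nat n + y) * (\<rho> + of_nat n + z)) / of_nat n ^ 3 =
      L (\<rho> + x) n * L (\<rho> + y) n * L (\<rho> + z) n" for x y z n
    by (simp add: L_def power3_eq_cube add_ac)
  show "(\<lambda>n. DF_R0 a b c g (\<rho> + of_nat n) / of_nat n ^ 3) \<longlonglongrightarrow> 1"
    using L3[of "\<rho> + 0" "\<rho> + (- 1 - a - c)" "\<rho> + (- 2 - 2*a - 2*c - g)"]
    unfolding split[symmetric] DF_R0_def by (simp add: algebra_simps)
  show "(\<lambda>n. DF_R2 a b c g (\<rho> + of_nat n) / of_nat n ^ 3) \<longlonglongrightarrow> 1"
    using L3[of "\<rho> + (b - c + 1)" "\<rho> + (- a - c - g)" "\<rho> + (- 2*a - b - c - g - 1)"]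
    unfolding split[symmetric] DF_R2_def by (simp add: algebra_simps)
  \<comment> \<open>The last summand of \<open>DF_R1\<close> is linear in m, so it disappears on
    division by n^3.\<close>
  have "(\<lambda>n. c * (2*b + 2 + g) * (2 * L (\<rho> - a - c - g/2 - 1/2) n * (1 / of_nat n) * (1 / of_nat n))) \<longlonglongrightarrow>
      c * (2*b + 2 + g) * (2 * 1 * 0 * 0)"
    by (intro tendsto_intros L lim_1_over_n)
  from tendsto_add[OF tendsto_add[OF L3 L3] this,
    of "\<rho> + (- 2*a - 2*c - g - 1)" "\<rho> + (- a - c)" "\<rho> + (b - c + 1)"
       "\<rho> + 0" "\<rho> + (- a - c - g - 1)" "\<rho> + (- 2*a - b - c - g - 2)"]
  have "(\<lambda>n. L (\<rho> + (- 2*a - 2*c - g - 1)) n * L (\<rho> + (- a - c)) n * L (\<rho> + (b - c + 1)) n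
      + L (\<rho> + 0) n * L (\<rho> + (- a - c - g - 1)) n * L (\<rho> + (- 2*a - b - c - g - 2)) n
      + c * (2*b + 2 + g) * (2 * L (\<rho> - a - c - g/2 - 1/2) n * (1 / of_nat n) * (1 / of_nat n))) \<longlonglongrightarrow> 2"
    by simp
  moreover have "2 * L (\<rho> - a - c - g/2 - 1/2) n * (1 / of_nat n) * (1 / of_nat n) =
      (2 * (\<rho> + of_nat n) - 2*a - 2*c - g - 1) / of_nat n ^ 3" for n
  proof -
    have "2 * (\<rho> + of_nat n) - 2*a - 2*c - g - 1 = 2 * (of_nat n + (\<rho> - a - c - g/2 - 1/2))"
      by (simp add: algebra_simps)
    then show ?thesis
      by (simp only: L_def power3_eq_cube) simp
  qed
  ultimately have "(\<lambda>n. L (\<rho> + (- 2*a - 2*c - g - 1)) n * L (\<rho> + (- a - c)) n * L (\<rho> + (b - c + 1)) n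
      + L (\<rho> + 0) n * L (\<rho> + (- a - c - g - 1)) n * L (\<rho> + (- 2*a - b - c - g - 2)) n
      + c * (2*b + 2 + g) * ((2 * (\<rho> + of_nat n) - 2*a - 2*c - g - 1) / of_nat n ^ 3)) \<longlonglongrightarrow> 2"
    by (simp only:)
  moreover have "DF_R1 a b c g (\<rho> + of_nat n) =
      (\<rho> + of_nat n + (- 2*a - 2*c - g - 1)) * (\<rho> + of_nat n + (- a - c)) * (\<rho> + of_nat n + (b - c + 1))
      + (\<rho> + of_nat n + 0) * (\<rho> + of_nat n + (- a - c - g - 1)) * (\<rho> + of_nat n + (- 2*a - b - c - g - 2))
      + c * (2*b + 2 + g) * (2 * (\<rho> + of_nat n) - 2*a - 2*c - g - 1)" for n
    unfolding DF_R1_def by algebra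
  ultimately show "(\<lambda>n. DF_R1 a b c g (\<rho> + of_nat n) / of_nat n ^ 3) \<longlonglongrightarrow> 2"
    by (simp only: add_divide_distrib split times_divide_eq_right)
qed

text \<open>The three cubics have leading coefficients 1, 2 and 1, so the recurrence solved for
  u_(n+2) tends to u_(n+2) = 2 u_(n+1) - u_n.\<close>

lemma conv_radius_DF_coeff: "conv_radius (DF_coeff a b c g \<rho>) \<ge> 1"
proof (rule conv_radius_ge_1_if_recurrence)
  let ?\<alpha> = "\<lambda>n. DF_R1 a b c g (\<rho> + of_nat (Suc n)) / DF_R0 a b c g (\<rho> + of_nat (Suc (Suc n)))"
  let ?\<beta> = "\<lambda>n. - DF_R2 a b c g (\<rho> + of_nat n) / DF_R0 a b c g (\<rho> + of_nat (Suc (Suc n)))"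
  show "DF_coeff a b c g \<rho> (Suc (Suc n)) = ?\<alpha> n * DF_coeff a b c g \<rho> (Suc n) + ?\<beta> n * DF_coeff a b c g \<rho> n"
    for n
    by (simp add: diff_divide_distrib)
  have shift: "\<rho> + of_nat (Suc n) = \<rho> + 1 + of_nat n" "\<rho> + 1 + of_nat (Suc n) = \<rho> + 2 + of_nat n" for n
    by simp_all
  have cancel: "\<forall>\<^sub>F n in sequentially. (x n / of_nat n ^ 3) / (y n / of_nat n ^ 3) = x n / y n"
    for x y :: "nat \<Rightarrow> complex"
    using eventually_gt_at_top[of 0] by eventually_elim simp
  have "(\<lambda>n. (DF_R1 a b c g (\<rho> + 1 + of_nat n) / of_nat n ^ 3) / (DF_R0 a b c g (\<rho> + 2 + of_nat n) / of_nat n ^ 3))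
      \<longlonglongrightarrow> 2"
    using tendsto_divide[OF DF_R_tendsto(2) DF_R_tendsto(1), of a b c g "\<rho> + 1" a b c g "\<rho> + 2"]
    by simp
  from Lim_transform_eventually[OF this cancel] show "?\<alpha> \<longlonglongrightarrow> 2"
    unfolding shift .
  have "(\<lambda>n. (- DF_R2 a b c g (\<rho> + of_nat n) / of_nat n ^ 3) / (DF_R0 a b c g (\<rho> + 2 + of_nat n) / of_nat n ^ 3))
      \<longlonglongrightarrow> - 1"
    using tendsto_divide[OF tendsto_minus[OF DF_R_tendsto(3)] DF_R_tendsto(1), of a b c g \<rho> a b c g "\<rho> + 2"]
    by simp
  from Lim_transform_eventually[OF this cancel] show "?\<beta> \<longlonglongrightarrow> - 1"
    unfolding shift .
qed

text \<open>Multiplication by the invertible series of (1-x)^(b+c+1) matches solutions of the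
  recurrence with formal solutions of the equation. The recurrence determines its solution, and the
  radius bound makes the formal solution analytic in the unit disc.\<close>

theorem DF_normalized_series_sums:
  assumes indicial: "DF_R0 a b c g \<rho> = 0" "\<And>n. DF_R0 a b c g (\<rho> + of_nat (Suc n)) \<noteq> 0"
  shows DF_normalized_series_ex1: "\<exists>!F. DF_normalized_series a b c g \<rho> F"
    and "\<And>u x. DF_recurrence a b c g \<rho> u \<Longrightarrow> u 0 = 1 \<Longrightarrow> norm x < 1 \<Longrightarrow>
      (\<lambda>n. u n * x ^ n) sums (eval_fps (THE F. DF_normalized_series a b c g \<rho> F) x / (1 - x) powr (b + c + 1))"
proof -
  let ?P = "fps_one_minus_powr (1 + b + c)" and ?Q = "fps_one_minus_powr (- (1 + b + c))"
  define H where "H = Abs_fps (DF_coeff a b c g \<rho>)"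
  have H_nth: "fps_nth H = DF_coeff a b c g \<rho>"
    by (simp add: H_def fun_eq_iff)
  have PQ: "?P * ?Q = 1"
    by (rule fps_one_minus_powr_mult_minus)
  have radius_H: "fps_conv_radius H \<ge> 1"
    by (simp add: fps_conv_radius_def H_nth conv_radius_DF_coeff)
  then have radius: "fps_conv_radius (?P * H) \<ge> 1"
    using eval_fps_one_minus_powr(1)[of "1 + b + c"] fps_conv_radius_mult[of ?P H]
    by (meson min.boundedI order_trans)
  have unique: "F = ?P * Abs_fps u"
    if "DF_fps_op a b c g \<rho> F = 0" "fps_nth F 0 = 1" "DF_recurrence a b c g \<rho> u" "u 0 = 1" for F u
  proof -
    have F: "F = ?P * (?Q * F)"
      using PQ by (metis mult.assoc mult_1)
    then have "?P * DF_rec_op a b c g \<rho> (?Q * F) = 0"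
      using that(1) by (metis DF_fps_op_powr_mult)
    then have "DF_rec_op a b c g \<rho> (?Q * F) = 0"
      using PQ by auto
    then have "DF_recurrence a b c g \<rho> (fps_nth (?Q * F))"
      using indicial(1) by (simp add: DF_rec_op_eq_0_iff)
    from DF_recurrence_unique[OF this that(3) _ indicial(2)] that(2,4)
    have "fps_nth (?Q * F) = u"
      by simp
    then have "?Q * F = Abs_fps u"
      by (metis fps_nth_inverse)
    from F[unfolded this] show ?thesis .
  qed
  have solution: "DF_normalized_series a b c g \<rho> (?P * H)"
    unfolding DF_normalized_series_iff DF_fps_op_powr_mult
    using radius indicial DF_recurrence_DF_coeff[OF indicial(2)]
    by (auto simp: H_nth DF_rec_op_eq_0_iff intro: less_le_trans[of 0 1])
  show ex1: "\<exists>!F. DF_normalized_series a b c g \<rho> F"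
  proof (rule ex1I)
    show "DF_normalized_series a b c g \<rho> (?P * H)"
      by (fact solution)
  next
    fix F assume "DF_normalized_series a b c g \<rho> F"
    then show "F = ?P * H"
      unfolding H_def DF_normalized_series_iff
      by (intro unique[OF _ _ DF_recurrence_DF_coeff[OF indicial(2)]]) auto
  qed
  fix u x assume u: "DF_recurrence a b c g \<rho> u" "u 0 = 1" and x: "norm (x :: complex) < 1"
  have the: "(THE F. DF_normalized_series a b c g \<rho> F) = ?P * H"
    using ex1 solution by (rule the1_equality)
  have uH: "u = fps_nth H"
    using DF_recurrence_unique[OF u(1) DF_recurrence_DF_coeff[OF indicial(2)] _ indicial(2)] u(2) H_nth
    by simp
  have "ereal (norm x) < 1"
    using x by (simp add: one_ereal_def)
  note x_radius = less_le_trans[OF this radius_H]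
    less_le_trans[OF this eval_fps_one_minus_powr(1)[of "1 + b + c"]]
  have "(1 - x) powr (b + c + 1) \<noteq> 0"
    using x by (auto simp: powr_def)
  moreover have "eval_fps (?P * H) x = (1 - x) powr (b + c + 1) * eval_fps H x"
    using x x_radius by (simp add: eval_fps_mult eval_fps_one_minus_powr(2) add_ac)
  ultimately show "(\<lambda>n. u n * x ^ n) sums (eval_fps (THE F. DF_normalized_series a b c g \<rho> F) x / (1 - x) powr (b + c + 1))"
    using sums_eval_fps[OF x_radius(1)] by (simp add: the uH)
qed

text \<open>An equivalence for every \<open>F\<close>: it transfers unique existence to the new
  parameters and also identifies the series that \<open>THE\<close> selects on the two sides of
  (3).\<close>

lemma DF_normalized_series_conjugate:
  "DF_normalized_series a b c g (2*a + 2*c + g + 2) F \<longleftrightarrow>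
   DF_normalized_series (- c - g/2 - 1) (a + b + c + g/2 + 1) (- a - g/2 - 1) g 0 F"
proof -
  let ?\<sigma> = "2*a + 2*c + g + 2"
  let ?a = "- c - g/2 - 1" and ?b = "a + b + c + g/2 + 1" and ?c = "- a - g/2 - 1"
  \<comment> \<open>Writing g = 2y turns the identities for the three cubics into polynomial ones
    without halves.\<close>
  define y where "y = g / 2"
  have g: "g = 2 * y" by (simp add: y_def)
  have R: "DF_R0 ?a ?b ?c g m = DF_R0 a b c g (?\<sigma> + m)" "DF_R1 ?a ?b ?c g m = DF_R1 a b c g (?\<sigma> + m)"
    "DF_R2 ?a ?b ?c g m = DF_R2 a b c g (?\<sigma> + m)" for m
    unfolding DF_R0_def DF_R1_def DF_R2_def y_def[symmetric] unfolding g by algebra+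
  have rec_op: "DF_rec_op a b c g ?\<sigma> H = DF_rec_op ?a ?b ?c g 0 H" for H
    by (rule fps_ext) (simp only: DF_rec_op_nth R add_0_left)
  have s: "1 + ?b + ?c = 1 + b + c"
    by simp
  let ?P = "fps_one_minus_powr (1 + b + c)" and ?Q = "fps_one_minus_powr (- (1 + b + c))"
  have F: "F = ?P * (?Q * F)"
    by (metis fps_one_minus_powr_mult_minus mult.assoc mult_1)
  have "DF_fps_op a b c g ?\<sigma> F = ?P * DF_rec_op a b c g ?\<sigma> (?Q * F)"
    by (subst F) (rule DF_fps_op_powr_mult)
  also have "\<dots> = DF_fps_op ?a ?b ?c g 0 F"
    by (subst (2) F) (simp only: rec_op DF_fps_op_powr_mult[where b = ?b and c = ?c, unfolded s])
  finally show ?thesis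
    by (simp add: DF_normalized_series_iff)
qed

text \<open>A change of gauge: the ratio of successive w_n moves linear factors of A and C into
  \<open>DF_R0\<close> and \<open>DF_R2\<close>, and the middle coefficient A + C - B is unaffected.
  C 0 = 0 removes the term with the truncated \<open>n - 1\<close>.\<close>

lemma DF_recurrence_of_difference_form:
  fixes A B C w W :: "nat \<Rightarrow> complex"
  assumes diff: "\<And>n. A n * (W (Suc n) - W n) - C n * (W n - W (n - 1)) + B n * W n = 0"
    and C0: "C 0 = 0"
    and R0: "\<And>n. A n * w n = DF_R0 a b c g (\<rho> + of_nat (Suc n)) * w (Suc n)"
    and R1: "\<And>n. DF_R1 a b c g (\<rho> + of_nat n) = A n + C n - B n"
    and R2: "\<And>n. C (Suc n) * w (Suc n) = DF_R2 a b c g (\<rho> + of_nat n) * w n"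
  shows "DF_recurrence a b c g \<rho> (\<lambda>n. w n * W n)"
  unfolding DF_recurrence_def
proof (intro conjI allI)
  have "DF_R0 a b c g (\<rho> + 1) * (w 1 * W 1) = w 0 * (A 0 * W (Suc 0))"
    using R0[of 0] by (simp add: mult.assoc[symmetric] mult.commute)
  also have "A 0 * W (Suc 0) = (A 0 - B 0) * W 0"
    using diff[of 0] by (simp add: C0 algebra_simps)
  finally show "DF_R0 a b c g (\<rho> + 1) * (w 1 * W 1) = DF_R1 a b c g \<rho> * (w 0 * W 0)"
    using R1[of 0] by (simp add: C0)
next
  fix n
  show "DF_R0 a b c g (\<rho> + of_nat (Suc (Suc n))) * (w (Suc (Suc n)) * W (Suc (Suc n))) =
        DF_R1 a b c g (\<rho> + of_nat (Suc n)) * (w (Suc n) * W (Suc n)) - DF_R2 a b c g (\<rho> + of_nat n) * (w n * W n)"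
    using diff[of "Suc n"] R0[of "Suc n"] R2[of n] unfolding R1 diff_Suc_1 by algebra
qed

text \<open>The disjunctions serve all three exponents at once: the factor that belongs to \<rho>
  itself equals n + 1, and the others are not integers.\<close>

lemma DF_R0_neq_0:
  assumes "\<rho> \<notin> \<int> \<or> \<rho> = 0" "\<rho> - a - c \<notin> \<int> \<or> \<rho> = a + c + 1" "\<rho> - 2*a - 2*c - g \<notin> \<int> \<or> \<rho> = 2*a + 2*c + g + 2"
  shows "DF_R0 a b c g (\<rho> + of_nat (Suc n)) \<noteq> 0"
proof -
  have int: "x + of_int k \<noteq> 0" if "x \<notin> \<int>" for x :: complex and k
    using that by (metis Ints_minus Ints_of_int add_eq_0_iff minus_minus)
  have nat: "1 + of_nat n \<noteq> (0 :: complex)"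
    by (metis of_nat_Suc of_nat_neq_0)
  have "\<rho> + of_nat (Suc n) \<noteq> 0"
    using assms(1) int[of \<rho> "int (Suc n)"] nat by auto
  moreover have "\<rho> + of_nat (Suc n) - 1 - a - c \<noteq> 0"
    using assms(2) int[of "\<rho> - a - c" "int n"] nat by (auto simp: algebra_simps)
  moreover have "\<rho> + of_nat (Suc n) - 2 - 2*a - 2*c - g \<noteq> 0"
    using assms(3) int[of "\<rho> - 2*a - 2*c - g" "int n - 1"] nat by (auto simp: algebra_simps)
  ultimately show ?thesis
    by (simp only: DF_R0_def mult_eq_0_iff simp_thms)
qed

section \<open>Coefficients of the local solutions\<close>

definition DF_u0 :: "complex \<Rightarrow> complex \<Rightarrow> complex \<Rightarrow> complex \<Rightarrow> nat \<Rightarrow> complex" where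
  "DF_u0 a b c g n = pochhammer (b - c + 1) n / fact n *
     racah (- 2*a - 2*c - g - 1) (- c) (b + 1 + g/2) (- a - c - g/2) (- a - c) (b - c + 1) n"

definition DF_u1 :: "complex \<Rightarrow> complex \<Rightarrow> complex \<Rightarrow> complex \<Rightarrow> nat \<Rightarrow> complex" where
  "DF_u1 a b c g n = pochhammer (a + b + 2) n * pochhammer (1 - g) n / (pochhammer (- a - c - g) n * fact n) *
     racah (1 - g) (a + 1) (a + b + c + 2 + g/2) (1 - g/2) (a + c + 2) (a + b + 2) n"

lemma DF_recurrence_DF_u0:
  assumes "- a - c - g/2 \<notin> \<int>" "- a - c \<notin> \<int>\<^sub>\<le>\<^sub>0" "b - c + 1 \<notin> \<int>\<^sub>\<le>\<^sub>0"
  shows "DF_recurrence a b c g 0 (DF_u0 a b c g)"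
proof -
  let ?t = "- 2*a - 2*c - g - 1" and ?e = "- a - c" and ?f = "b - c + 1"
  \<comment> \<open>Its ratio (f+n)/(n+1) trades the factor n + f of the forward coefficient for the
    n + 1 of \<open>DF_R0\<close>, and the n + 1 of the backward coefficient for the factor n + f of
    \<open>DF_R2\<close>.\<close>
  define w where "w n = pochhammer ?f n / fact n" for n
  have w: "of_nat (Suc n) * w (Suc n) = (?f + of_nat n) * w n" for n
    by (simp add: w_def pochhammer_Suc del: of_nat_Suc)
  have "DF_recurrence a b c g 0 (\<lambda>n. w n * racah ?t (- c) (b + 1 + g/2) (- a - c - g/2) ?e ?f n)"
  proof (rule DF_recurrence_of_difference_form)
    fix n
    show "(of_nat n + ?t) * (of_nat n + ?e) * (of_nat n + ?f) * w n =
        DF_R0 a b c g (0 + of_nat (Suc n)) * w (Suc n)"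
      using w[of n] unfolding DF_R0_def of_nat_Suc by algebra
    show "of_nat (Suc n) * (of_nat (Suc n) + ?t - ?e) * (of_nat (Suc n) + ?t - ?f) * w (Suc n) =
        DF_R2 a b c g (0 + of_nat n) * w n"
      using w[of n] unfolding DF_R2_def of_nat_Suc by algebra
    show "DF_R1 a b c g (0 + of_nat n) = (of_nat n + ?t) * (of_nat n + ?e) * (of_nat n + ?f)
        + of_nat n * (of_nat n + ?t - ?e) * (of_nat n + ?t - ?f)
        - 2 * (- c) * (b + 1 + g/2) * (2 * of_nat n + ?t)"
      by (simp add: DF_R1_def algebra_simps)
  next
    fix n
    show "(of_nat n + ?t) * (of_nat n + ?e) * (of_nat n + ?f) *
         (racah ?t (- c) (b + 1 + g/2) (- a - c - g/2) ?e ?f (Suc n) - racah ?t (- c) (b + 1 + g/2) (- a - c - g/2) ?e ?f n)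
       - of_nat n * (of_nat n + ?t - ?e) * (of_nat n + ?t - ?f) *
         (racah ?t (- c) (b + 1 + g/2) (- a - c - g/2) ?e ?f n - racah ?t (- c) (b + 1 + g/2) (- a - c - g/2) ?e ?f (n - 1))
       + 2 * (- c) * (b + 1 + g/2) * (2 * of_nat n + ?t) * racah ?t (- c) (b + 1 + g/2) (- a - c - g/2) ?e ?f n = 0"
      by (rule racah_recurrence_half) (use assms in \<open>simp_all add: field_simps\<close>)
  qed simp
  then show ?thesis
    by (simp add: DF_u0_def[abs_def] w_def)
qed

lemma DF_recurrence_DF_u1:
  assumes "1 - g/2 \<notin> \<int>" "a + c + 2 \<notin> \<int>\<^sub>\<le>\<^sub>0" "a + b + 2 \<notin> \<int>\<^sub>\<le>\<^sub>0" "- a - c - g \<notin> \<int>\<^sub>\<le>\<^sub>0"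
  shows "DF_recurrence a b c g (a + c + 1) (DF_u1 a b c g)"
proof -
  let ?t = "1 - g" and ?e = "a + c + 2" and ?f = "a + b + 2"
  let ?W = "racah ?t (a + 1) (a + b + c + 2 + g/2) (1 - g/2) ?e ?f"
  \<comment> \<open>The ratio is now (f+n)(t+n)/((n+1)(n-a-c-g)), because of the three factors of
    \<open>DF_R0\<close> only n + e occurs in the forward coefficient.\<close>
  define w where "w n = pochhammer ?f n * pochhammer ?t n / (pochhammer (- a - c - g) n * fact n)" for n
  have w: "of_nat (Suc n) * (- a - c - g + of_nat n) * w (Suc n) = (?f + of_nat n) * (?t + of_nat n) * w n" for n
  proof -
    have "pochhammer (- a - c - g) n \<noteq> 0" "- a - c - g + of_nat n \<noteq> 0"
      using pochhammer_neq_0_if_not_nonpos_Int[OF assms(4)] plus_of_nat_eq_0_imp assms(4) by blast+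
    then show ?thesis
      by (simp add: w_def pochhammer_Suc del: of_nat_Suc)
  qed
  have "DF_recurrence a b c g (a + c + 1) (\<lambda>n. w n * ?W n)"
  proof (rule DF_recurrence_of_difference_form)
    fix n
    show "(of_nat n + ?t) * (of_nat n + ?e) * (of_nat n + ?f) * w n =
        DF_R0 a b c g (a + c + 1 + of_nat (Suc n)) * w (Suc n)"
      using w[of n] unfolding DF_R0_def of_nat_Suc by algebra
    show "of_nat (Suc n) * (of_nat (Suc n) + ?t - ?e) * (of_nat (Suc n) + ?t - ?f) * w (Suc n) =
        DF_R2 a b c g (a + c + 1 + of_nat n) * w n"
      using w[of n] unfolding DF_R2_def of_nat_Suc by algebra
    show "DF_R1 a b c g (a + c + 1 + of_nat n) = (of_nat n + ?t) * (of_nat n + ?e) * (of_nat n + ?f)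
        + of_nat n * (of_nat n + ?t - ?e) * (of_nat n + ?t - ?f)
        - 2 * (a + 1) * (a + b + c + 2 + g/2) * (2 * of_nat n + ?t)"
      by (simp add: DF_R1_def algebra_simps)
  next
    fix n
    show "(of_nat n + ?t) * (of_nat n + ?e) * (of_nat n + ?f) * (?W (Suc n) - ?W n)
       - of_nat n * (of_nat n + ?t - ?e) * (of_nat n + ?t - ?f) * (?W n - ?W (n - 1))
       + 2 * (a + 1) * (a + b + c + 2 + g/2) * (2 * of_nat n + ?t) * ?W n = 0"
      by (rule racah_recurrence_half) (use assms in \<open>simp_all add: field_simps\<close>)
  qed simp
  then show ?thesis
    by (simp add: DF_u1_def[abs_def] w_def)
qed

text \<open>Whipple's transformation is applied with \<alpha> = -c and \<gamma> - \<beta> = b+1+g/2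
  each time, and with \<gamma> equal to -a-c, b-c+1 and -a-c-g/2 in turn. The ratio before each
  product reduces its prefactor to (b-c+1)_n/n!.\<close>

lemma DF_u0_eq:
  assumes "c \<notin> \<int>" "- a - c \<notin> \<int>\<^sub>\<le>\<^sub>0" "- a - c - g \<notin> \<int>\<^sub>\<le>\<^sub>0" "b - c + 1 \<notin> \<int>\<^sub>\<le>\<^sub>0"
    "- a - c - g/2 \<notin> \<int>\<^sub>\<le>\<^sub>0" "- 2*a - b - c - g - 1 \<notin> \<int>\<^sub>\<le>\<^sub>0"
  shows "pochhammer (- a - c - g) n / pochhammer (- a - c - g/2) n
      * fps_nth (gauss_2F1 (- c) (- a - b - c - g/2 - 1) (- a - c)
                 * gauss_2F1 (b + 1) (- a - g/2) (- a - c - g)) n = DF_u0 a b c g n" (is ?first)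
    and "pochhammer (- 2*a - b - c - g - 1) n * pochhammer (b - c + 1) n
         / (pochhammer (- a - c) n * pochhammer (- a - c - g/2) n)
       * fps_nth (gauss_2F1 (- c) (- c - g/2) (b - c + 1)
                  * gauss_2F1 (- a) (- a - g/2) (- 2*a - b - c - g - 1)) n = DF_u0 a b c g n" (is ?second)
    and "pochhammer (- a - c - g/2) n / pochhammer (- a - c) n
       * fps_nth (gauss_2F1 (- c) (- a - b - c - g - 1) (- a - c - g/2)
                  * gauss_2F1 (b + 1) (- a) (- a - c - g/2)) n = DF_u0 a b c g n" (is ?third)
proof -
  note nz = assms(2-)[THEN pochhammer_neq_0_if_not_nonpos_Int, of n]
  have eqs: "- c + (b + 1) = b - c + 1" "- c + (- a - g/2) = - a - c - g/2" "- c + - a = - a - c"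
    "- a - c + (- a - c - g) - 1 = - 2*a - 2*c - g - 1"
    "b - c + 1 + (- 2*a - b - c - g - 1) - 1 = - 2*a - 2*c - g - 1"
    "- a - c - g/2 + (- a - c - g/2) - 1 = - 2*a - 2*c - g - 1"
    "- a - c - (- a - b - c - g/2 - 1) = b + 1 + g/2" "b - c + 1 - (- c - g/2) = b + 1 + g/2"
    "- a - c - g/2 - (- a - b - c - g - 1) = b + 1 + g/2"
    by (simp_all add: field_simps)
  let ?W = "racah (- 2*a - 2*c - g - 1) (- c) (b + 1 + g/2)"
  have swap: "?W (- a - c) (b - c + 1) (- a - c - g/2) = ?W (- a - c - g/2) (- a - c) (b - c + 1)"
    "?W (b - c + 1) (- a - c) (- a - c - g/2) = ?W (- a - c - g/2) (- a - c) (b - c + 1)"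
    "?W (- a - c - g/2) (b - c + 1) (- a - c) = ?W (- a - c - g/2) (- a - c) (b - c + 1)"
    by (metis racah_swap)+
  have "fps_nth (gauss_2F1 (- c) (- a - b - c - g/2 - 1) (- a - c) * gauss_2F1 (b + 1) (- a - g/2) (- a - c - g)) n =
      pochhammer (b - c + 1) n * pochhammer (- a - c - g/2) n / (pochhammer (- a - c - g) n * fact n) * ?W (- a - c - g/2) (- a - c) (b - c + 1) n"
    by (rule gauss_2F1_mult_nth_eq_racah[of "- c" "- a - b - c - g/2 - 1" "- a - c" "b + 1" "- a - g/2" "- a - c - g" n, unfolded eqs swap])
      (use assms in \<open>simp_all add: field_simps minus_in_Ints_iff\<close>)
  with nz show ?first
    by (simp add: DF_u0_def)
  have "fps_nth (gauss_2F1 (- c) (- c - g/2) (b - c + 1) * gauss_2F1 (- a) (- a - g/2) (- 2*a - b - c - g - 1)) n =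
      pochhammer (- a - c) n * pochhammer (- a - c - g/2) n / (pochhammer (- 2*a - b - c - g - 1) n * fact n) * ?W (- a - c - g/2) (- a - c) (b - c + 1) n"
    by (rule gauss_2F1_mult_nth_eq_racah[of "- c" "- c - g/2" "b - c + 1" "- a" "- a - g/2" "- 2*a - b - c - g - 1" n, unfolded eqs swap])
      (use assms in \<open>simp_all add: field_simps minus_in_Ints_iff\<close>)
  with nz show ?second
    by (simp add: DF_u0_def)
  have "fps_nth (gauss_2F1 (- c) (- a - b - c - g - 1) (- a - c - g/2) * gauss_2F1 (b + 1) (- a) (- a - c - g/2)) n =
      pochhammer (b - c + 1) n * pochhammer (- a - c) n / (pochhammer (- a - c - g/2) n * fact n) * ?W (- a - c - g/2) (- a - c) (b - c + 1) n"
    by (rule gauss_2F1_mult_nth_eq_racah[of "- c" "- a - b - c - g - 1" "- a - c - g/2" "b + 1" "- a" "- a - c - g/2" n, unfolded eqs swap])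
      (use assms in \<open>simp_all add: field_simps minus_in_Ints_iff\<close>)
  with nz show ?third
    by (simp add: DF_u0_def)
qed

text \<open>Here \<alpha> = a+1 and \<gamma> - \<beta> = a+b+c+2+g/2 each time, and \<gamma> is
  a+c+2, a+b+2 and 1-g/2 in turn.\<close>

lemma DF_u1_eq:
  assumes "a \<notin> \<int>" "a + c + 2 \<notin> \<int>\<^sub>\<le>\<^sub>0" "- a - c - g \<notin> \<int>\<^sub>\<le>\<^sub>0" "a + b + 2 \<notin> \<int>\<^sub>\<le>\<^sub>0"
    "1 - g/2 \<notin> \<int>\<^sub>\<le>\<^sub>0" "- a - b - g \<notin> \<int>\<^sub>\<le>\<^sub>0"
  shows "pochhammer (1 - g) n / pochhammer (1 - g/2) n
       * fps_nth (gauss_2F1 (b + 1) (- a - g/2) (- a - c - g)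
                  * gauss_2F1 (a + 1) (- b - g/2) (a + c + 2)) n = DF_u1 a b c g n" (is ?first)
    and "pochhammer (1 - g) n * pochhammer (a + b + 2) n * pochhammer (- a - b - g) n
         / (pochhammer (1 - g/2) n * pochhammer (- a - c - g) n * pochhammer (a + c + 2) n)
       * fps_nth (gauss_2F1 (c + 1) (- a - g/2) (- a - b - g)
                  * gauss_2F1 (a + 1) (- c - g/2) (a + b + 2)) n = DF_u1 a b c g n" (is ?second)
    and "pochhammer (1 - g/2) n * pochhammer (1 - g) n
         / (pochhammer (- a - c - g) n * pochhammer (a + c + 2) n)
       * fps_nth (gauss_2F1 (a + 1) (- a - b - c - g - 1) (1 - g/2)
                  * gauss_2F1 (b + 1) (c + 1) (1 - g/2)) n = DF_u1 a b c g n" (is ?third)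
proof -
  note nz = assms(2-)[THEN pochhammer_neq_0_if_not_nonpos_Int, of n]
  have "a + 1 \<notin> \<int>"
    using assms(1) Ints_diff[of "a + 1" 1] by auto
  note assms = assms this
  have eqs: "a + 1 + (b + 1) = a + b + 2" "a + 1 + (- a - g/2) = 1 - g/2" "a + 1 + (c + 1) = a + c + 2"
    "a + c + 2 + (- a - c - g) - 1 = 1 - g" "a + b + 2 + (- a - b - g) - 1 = 1 - g"
    "1 - g/2 + (1 - g/2) - 1 = 1 - g"
    "a + c + 2 - (- b - g/2) = a + b + c + 2 + g/2" "a + b + 2 - (- c - g/2) = a + b + c + 2 + g/2"
    "1 - g/2 - (- a - b - c - g - 1) = a + b + c + 2 + g/2"
    by (simp_all add: field_simps)
  let ?W = "racah (1 - g) (a + 1) (a + b + c + 2 + g/2)"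
  have swap: "?W (a + c + 2) (a + b + 2) (1 - g/2) = ?W (1 - g/2) (a + c + 2) (a + b + 2)"
    "?W (a + b + 2) (a + c + 2) (1 - g/2) = ?W (1 - g/2) (a + c + 2) (a + b + 2)"
    "?W (1 - g/2) (a + b + 2) (a + c + 2) = ?W (1 - g/2) (a + c + 2) (a + b + 2)"
    by (metis racah_swap)+
  \<comment> \<open>In this and the next product the factors are exchanged, so that the one with the
    parameter a + 1 comes first.\<close>
  have "fps_nth (gauss_2F1 (a + 1) (- b - g/2) (a + c + 2) * gauss_2F1 (b + 1) (- a - g/2) (- a - c - g)) n =
      pochhammer (a + b + 2) n * pochhammer (1 - g/2) n / (pochhammer (- a - c - g) n * fact n) * ?W (1 - g/2) (a + c + 2) (a + b + 2) n"
    by (rule gauss_2F1_mult_nth_eq_racah[of "a + 1" "- b - g/2" "a + c + 2" "b + 1" "- a - g/2" "- a - c - g" n, unfolded eqs swap])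
      (use assms in \<open>simp_all add: field_simps minus_in_Ints_iff\<close>)
  with nz show ?first
    by (simp add: DF_u1_def mult.commute[of "gauss_2F1 (b + 1) _ _"])
  have "fps_nth (gauss_2F1 (a + 1) (- c - g/2) (a + b + 2) * gauss_2F1 (c + 1) (- a - g/2) (- a - b - g)) n =
      pochhammer (a + c + 2) n * pochhammer (1 - g/2) n / (pochhammer (- a - b - g) n * fact n) * ?W (1 - g/2) (a + c + 2) (a + b + 2) n"
    by (rule gauss_2F1_mult_nth_eq_racah[of "a + 1" "- c - g/2" "a + b + 2" "c + 1" "- a - g/2" "- a - b - g" n, unfolded eqs swap])
      (use assms in \<open>simp_all add: field_simps minus_in_Ints_iff\<close>)
  with nz show ?second
    by (simp add: DF_u1_def mult.commute[of "gauss_2F1 (c + 1) _ _"])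
  have "fps_nth (gauss_2F1 (a + 1) (- a - b - c - g - 1) (1 - g/2) * gauss_2F1 (b + 1) (c + 1) (1 - g/2)) n =
      pochhammer (a + b + 2) n * pochhammer (a + c + 2) n / (pochhammer (1 - g/2) n * fact n) * ?W (1 - g/2) (a + c + 2) (a + b + 2) n"
    by (rule gauss_2F1_mult_nth_eq_racah[of "a + 1" "- a - b - c - g - 1" "1 - g/2" "b + 1" "c + 1" "1 - g/2" n, unfolded eqs swap])
      (use assms in \<open>simp_all add: field_simps minus_in_Ints_iff\<close>)
  with nz show ?third
    by (simp add: DF_u1_def)
qed

section \<open>Generic parameters\<close>

definition affine_form :: "int \<Rightarrow> int \<Rightarrow> int \<Rightarrow> int \<Rightarrow> int \<Rightarrow> complex \<Rightarrow> complex \<Rightarrow> complex \<Rightarrow> complex \<Rightarrow> complex" where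
  "affine_form k i j l m a b c g =
     of_int k + of_int i * a + of_int j * b + of_int l * c + of_int m * g"

lemma proper_hypersurface_affine_form:
  assumes "(i, j, l, m) \<noteq> (0, 0, 0, 0)"
  shows "proper_hypersurface {(a, b, c, g). affine_form k i j l m a b c g = 0}"
proof -
  \<comment> \<open>In the nesting used by \<open>poly4\<close> the innermost variable is a and the
    outermost is g.\<close>
  let ?P = "[:[:[:[:of_int k, of_int i:], [:of_int j:]:], [:[:of_int l:]:]:], [:[:[:of_int m:]:]:]:]
    :: complex poly poly poly poly"
  have "?P \<noteq> 0"
    using assms by auto
  moreover have "affine_form k i j l m a b c g = poly4 ?P a b c g" for a b c g
    by (simp add: poly4_def affine_form_def algebra_simps)
  ultimately show ?thesis
    unfolding proper_hypersurface_def by (intro exI[of _ ?P] conjI) (assumption, simp only:)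
qed

text \<open>A single family is avoided once and for all: all hyperplanes with integer coefficients.
  It is countable, and each nonresonance condition below keeps an integral combination of the
  parameters, or half of one, away from the integers.\<close>

lemma generically_affine_form:
  assumes "\<And>a b c g. (\<And>k i j l m. (i, j, l, m) \<noteq> (0, 0, 0, 0) \<Longrightarrow> affine_form k i j l m a b c g \<noteq> 0) \<Longrightarrow> Q a b c g"
  shows "generically Q"
  unfolding generically_def
proof (intro exI conjI ballI allI impI)
  let ?V = "(\<lambda>(k, i, j, l, m). {(a, b, c, g). affine_form k i j l m a b c g = 0}) `
    {(k, i, j, l, m). (i, j, l, m) \<noteq> (0, 0, 0, 0)}"
  show "countable ?V"
    by (rule countable_image) simp
  show "proper_hypersurface V" if "V \<in> ?V" for V
    using that by (elim imageE) (clarsimp intro!: proper_hypersurface_affine_form)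
  show "Q a b c g" if "(a, b, c, g) \<notin> \<Union> ?V" for a b c g
  proof (rule assms)
    fix k i j l m :: int assume "(i, j, l, m) \<noteq> (0, 0, 0, 0)"
    then have "{(a, b, c, g). affine_form k i j l m a b c g = 0} \<in> ?V"
      by (intro image_eqI[of _ _ "(k, i, j, l, m)"]) simp_all
    from UnionI[OF this] that have "(a, b, c, g) \<notin> {(a, b, c, g). affine_form k i j l m a b c g = 0}"
      by (rule contrapos_nn[rotated])
    then show "affine_form k i j l m a b c g \<noteq> 0"
      by simp
  qed
qed

lemma affine_form_notin_Ints:
  assumes generic: "\<And>k i j l m. (i, j, l, m) \<noteq> (0, 0, 0, 0) \<Longrightarrow> affine_form k i j l m a b c g \<noteq> 0"
    and "(i, j, l, m) \<noteq> (0, 0, 0, 0)"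
  shows "of_int i * a + of_int j * b + of_int l * c + of_int m * g \<notin> \<int>"
proof
  assume "of_int i * a + of_int j * b + of_int l * c + of_int m * g \<in> \<int>"
  then obtain z where "of_int i * a + of_int j * b + of_int l * c + of_int m * g = of_int z"
    by (auto elim: Ints_cases)
  then have "affine_form (- z) i j l m a b c g = 0"
    by (simp add: affine_form_def algebra_simps)
  with assms show False
    by blast
qed

text \<open>The third alternative serves the parameters that contain g/2.\<close>

lemma notin_Ints_shift:
  fixes x y :: "'a::ring_1"
  assumes "y \<notin> \<int>" "x + y \<in> \<int> \<or> x - y \<in> \<int> \<or> 2 * x + y \<in> \<int>"
  shows "x \<notin> \<int>"
proof
  assume "x \<in> \<int>"
  then have "y \<in> \<int>"
    using assms(2) Ints_diff[of "x + y" x] Ints_diff[of x "x - y"] Ints_diff[of "2 * x + y" "2 * x"]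
      Ints_mult[of 2 x] by auto
  with assms(1) show False ..
qed

text \<open>The clauses on unique existence give meaning to the \<open>THE\<close> in
  \<open>DF_local_solution\<close>. The point 0 is left out because \<open>0 powr 0 = 0\<close>,
  while the normalized series has the value 1 there. In (2) the power of x divides out, so the cut
  does not matter.\<close>

theorem proposition13p1:
  shows "generically (\<lambda>a b c g.
    (\<comment> \<open>the normalized local solutions are well defined\<close>
     (\<exists>!F. DF_normalized_series a b c g 0 F) \<and>
     (\<exists>!F. DF_normalized_series a b c g (a + c + 1) F) \<and>
     (\<exists>!F. DF_normalized_series a b c g (2*a + 2*c + g + 2) F) \<and>
     (\<exists>!F. DF_normalized_series (- c - g/2 - 1) (a + b + c + g/2 + 1) (- a - g/2 - 1) g 0 F))
    \<and>
    (\<forall>x. x \<noteq> 0 \<and> norm x < 1 \<longrightarrow>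
      \<comment> \<open>(1)\<close>
      (\<lambda>n. x^n * (pochhammer (- a - c - g) n / pochhammer (- a - c - g/2) n)
           * fps_nth (gauss_2F1 (- c) (- a - b - c - g/2 - 1) (- a - c)
                      * gauss_2F1 (b + 1) (- a - g/2) (- a - c - g)) n)
        sums (f_DF00 a b c g x / (1 - x) powr (b + c + 1)) \<and>
      (\<lambda>n. x^n * (pochhammer (- 2*a - b - c - g - 1) n * pochhammer (b - c + 1) n
                  / (pochhammer (- a - c) n * pochhammer (- a - c - g/2) n))
           * fps_nth (gauss_2F1 (- c) (- c - g/2) (b - c + 1)
                      * gauss_2F1 (- a) (- a - g/2) (- 2*a - b - c - g - 1)) n)
        sums (f_DF00 a b c g x / (1 - x) powr (b + c + 1)) \<and>
      (\<lambda>n. x^n * (pochhammer (- a - c - g/2) n / pochhammer (- a - c) n)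
           * fps_nth (gauss_2F1 (- c) (- a - b - c - g - 1) (- a - c - g/2)
                      * gauss_2F1 (b + 1) (- a) (- a - c - g/2)) n)
        sums (f_DF00 a b c g x / (1 - x) powr (b + c + 1)) \<and>
      \<comment> \<open>(2)\<close>
      (\<lambda>n. x^n * (pochhammer (1 - g) n / pochhammer (1 - g/2) n)
           * fps_nth (gauss_2F1 (b + 1) (- a - g/2) (- a - c - g)
                      * gauss_2F1 (a + 1) (- b - g/2) (a + c + 2)) n)
        sums (f_DF01 a b c g x / (x powr (a + c + 1) * (1 - x) powr (b + c + 1))) \<and>
      (\<lambda>n. x^n * (pochhammer (1 - g) n * pochhammer (a + b + 2) n * pochhammer (- a - b - g) n
                  / (pochhammer (1 - g/2) n * pochhammer (- a - c - g) n
                     * pochhammer (a + c + 2) n))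
           * fps_nth (gauss_2F1 (c + 1) (- a - g/2) (- a - b - g)
                      * gauss_2F1 (a + 1) (- c - g/2) (a + b + 2)) n)
        sums (f_DF01 a b c g x / (x powr (a + c + 1) * (1 - x) powr (b + c + 1))) \<and>
      (\<lambda>n. x^n * (pochhammer (1 - g/2) n * pochhammer (1 - g) n
                  / (pochhammer (- a - c - g) n * pochhammer (a + c + 2) n))
           * fps_nth (gauss_2F1 (a + 1) (- a - b - c - g - 1) (1 - g/2)
                      * gauss_2F1 (b + 1) (c + 1) (1 - g/2)) n)
        sums (f_DF01 a b c g x / (x powr (a + c + 1) * (1 - x) powr (b + c + 1))) \<and>
      \<comment> \<open>(3)\<close>
      f_DF02 a b c g x =
        x powr (2*a + 2*c + g + 2)
        * f_DF00 (- c - g/2 - 1) (a + b + c + g/2 + 1) (- a - g/2 - 1) g x))"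
proof (rule generically_affine_form, intro conjI allI impI)
  fix a b c g
  assume generic: "\<And>k i j l m. (i, j, l, m) \<noteq> (0, 0, 0, 0) \<Longrightarrow> affine_form k i j l m a b c g \<noteq> 0"
  note notin = affine_form_notin_Ints[OF generic]
  have notin_Ints: "c \<notin> \<int>" "a \<notin> \<int>" "g \<notin> \<int>" "a + c \<notin> \<int>" "a + c + g \<notin> \<int>" "2*a + 2*c + g \<notin> \<int>"
    "b - c \<notin> \<int>" "2*a + b + c + g \<notin> \<int>" "a + b \<notin> \<int>" "a + b + g \<notin> \<int>"
    using notin[of 0 0 1 0] notin[of 1 0 0 0] notin[of 0 0 0 1] notin[of 1 0 1 0] notin[of 1 0 1 1]
      notin[of 2 0 2 1] notin[of 0 1 "- 1" 0] notin[of 2 1 1 1] notin[of 1 1 0 0] notin[of 1 1 0 1]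
    by simp_all
  note shift = this[THEN notin_Ints_shift]
  have half: "- a - c - g/2 \<notin> \<int>" "1 - g/2 \<notin> \<int>"
    by (rule shift(6) shift(3); simp)+
  have nonint: "- a - c \<notin> \<int>" "- a - c - g \<notin> \<int>" "b - c + 1 \<notin> \<int>" "- 2*a - b - c - g - 1 \<notin> \<int>"
    "a + c + 2 \<notin> \<int>" "a + b + 2 \<notin> \<int>" "- a - b - g \<notin> \<int>"
    by (rule shift(4) shift(5) shift(7) shift(8) shift(9) shift(10); simp; fail)+
  have nonint': "- 2*a - 2*c - g \<notin> \<int>" "a + c + 1 \<notin> \<int>" "1 - a - c - g \<notin> \<int>" "2*a + 2*c + g + 2 \<notin> \<int>"
    "a + c + g + 2 \<notin> \<int>"
    by (rule shift(4) shift(5) shift(6); simp; fail)+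
  note nonpos = half[THEN contra_subsetD[OF nonpos_Ints_subset_Ints]] nonint[THEN contra_subsetD[OF nonpos_Ints_subset_Ints]]
  let ?\<sigma> = "2*a + 2*c + g + 2"
  have indicial: "DF_R0 a b c g 0 = 0" "DF_R0 a b c g (a + c + 1) = 0" "DF_R0 a b c g ?\<sigma> = 0"
    by (simp_all add: DF_R0_def)
  have regular: "DF_R0 a b c g (0 + of_nat (Suc n)) \<noteq> 0"
    "DF_R0 a b c g (a + c + 1 + of_nat (Suc n)) \<noteq> 0" "DF_R0 a b c g (?\<sigma> + of_nat (Suc n)) \<noteq> 0" for n
    using nonint nonint' by (intro DF_R0_neq_0; simp add: algebra_simps)+
  note sol0 = DF_normalized_series_sums[OF indicial(1) regular(1)]
  note sol1 = DF_normalized_series_sums[OF indicial(2) regular(2)]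
  note sol2 = DF_normalized_series_sums[OF indicial(3) regular(3)]
  show "\<exists>!F. DF_normalized_series a b c g 0 F" "\<exists>!F. DF_normalized_series a b c g (a + c + 1) F"
    "\<exists>!F. DF_normalized_series a b c g ?\<sigma> F"
    by (fact sol0 sol1 sol2)+
  then show "\<exists>!F. DF_normalized_series (- c - g/2 - 1) (a + b + c + g/2 + 1) (- a - g/2 - 1) g 0 F"
    by (simp only: DF_normalized_series_conjugate)
  fix x :: complex assume x: "x \<noteq> 0 \<and> norm x < 1"
  have "DF_u0 a b c g 0 = 1" "DF_u1 a b c g 0 = 1"
    by (simp_all add: DF_u0_def DF_u1_def)
  note sums0 = sol0(2)[OF DF_recurrence_DF_u0[OF half(1) nonpos(3,5)] this(1)]
    and sums1 = sol1(2)[OF DF_recurrence_DF_u1[OF half(2) nonpos(7,8,4)] this(2)]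
  \<comment> \<open>Reduces each formula of (1) to a termwise identity with the solution of the
    recurrence.\<close>
  have f0: "(\<lambda>n. x ^ n * r n * q n) sums (f_DF00 a b c g x / (1 - x) powr (b + c + 1))"
    if "\<And>n. r n * q n = DF_u0 a b c g n" for r q
    using sums0[of x] x
    by (simp add: f_DF00_def DF_local_solution_def mult.assoc that mult.commute[of "DF_u0 _ _ _ _ _"])
  have f1: "(\<lambda>n. x ^ n * r n * q n) sums
      (f_DF01 a b c g x / (x powr (a + c + 1) * (1 - x) powr (b + c + 1)))"
    if "\<And>n. r n * q n = DF_u1 a b c g n" for r q
    using sums1[of x] x
    by (simp add: f_DF01_def DF_local_solution_def mult.assoc that mult.commute[of "DF_u1 _ _ _ _ _"])
  note u0 = DF_u0_eq[OF notin_Ints(1) nonpos(3,4,5,1,6)] and u1 = DF_u1_eq[OF notin_Ints(2) nonpos(7,4,8,2,9)]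
  show "(\<lambda>n. x^n * (pochhammer (- a - c - g) n / pochhammer (- a - c - g/2) n)
           * fps_nth (gauss_2F1 (- c) (- a - b - c - g/2 - 1) (- a - c)
                      * gauss_2F1 (b + 1) (- a - g/2) (- a - c - g)) n)
        sums (f_DF00 a b c g x / (1 - x) powr (b + c + 1))"
    by (rule f0[OF u0(1)])
  show "(\<lambda>n. x^n * (pochhammer (- 2*a - b - c - g - 1) n * pochhammer (b - c + 1) n
                  / (pochhammer (- a - c) n * pochhammer (- a - c - g/2) n))
           * fps_nth (gauss_2F1 (- c) (- c - g/2) (b - c + 1)
                      * gauss_2F1 (- a) (- a - g/2) (- 2*a - b - c - g - 1)) n)
        sums (f_DF00 a b c g x / (1 - x) powr (b + c + 1))"
    by (rule f0[OF u0(2)])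
  show "(\<lambda>n. x^n * (pochhammer (- a - c - g/2) n / pochhammer (- a - c) n)
           * fps_nth (gauss_2F1 (- c) (- a - b - c - g - 1) (- a - c - g/2)
                      * gauss_2F1 (b + 1) (- a) (- a - c - g/2)) n)
        sums (f_DF00 a b c g x / (1 - x) powr (b + c + 1))"
    by (rule f0[OF u0(3)])
  show "(\<lambda>n. x^n * (pochhammer (1 - g) n / pochhammer (1 - g/2) n)
           * fps_nth (gauss_2F1 (b + 1) (- a - g/2) (- a - c - g)
                      * gauss_2F1 (a + 1) (- b - g/2) (a + c + 2)) n)
        sums (f_DF01 a b c g x / (x powr (a + c + 1) * (1 - x) powr (b + c + 1)))"
    by (rule f1[OF u1(1)])
  show "(\<lambda>n. x^n * (pochhammer (1 - g) n * pochhammer (a + b + 2) n * pochhammer (- a - b - g) n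
                  / (pochhammer (1 - g/2) n * pochhammer (- a - c - g) n
                     * pochhammer (a + c + 2) n))
           * fps_nth (gauss_2F1 (c + 1) (- a - g/2) (- a - b - g)
                      * gauss_2F1 (a + 1) (- c - g/2) (a + b + 2)) n)
        sums (f_DF01 a b c g x / (x powr (a + c + 1) * (1 - x) powr (b + c + 1)))"
    by (rule f1[OF u1(2)])
  show "(\<lambda>n. x^n * (pochhammer (1 - g/2) n * pochhammer (1 - g) n
                  / (pochhammer (- a - c - g) n * pochhammer (a + c + 2) n))
           * fps_nth (gauss_2F1 (a + 1) (- a - b - c - g - 1) (1 - g/2)
                      * gauss_2F1 (b + 1) (c + 1) (1 - g/2)) n)
        sums (f_DF01 a b c g x / (x powr (a + c + 1) * (1 - x) powr (b + c + 1)))"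
    by (rule f1[OF u1(3)])
  \<comment> \<open>Both sides select the same power series, and the factor \<open>x powr 0\<close>
    is 1 because x is nonzero.\<close>
  show "f_DF02 a b c g x =
        x powr ?\<sigma> * f_DF00 (- c - g/2 - 1) (a + b + c + g/2 + 1) (- a - g/2 - 1) g x"
    using x by (simp add: f_DF02_def f_DF00_def DF_local_solution_def
        DF_normalized_series_conjugate[abs_def])
qed

end
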